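(* For any PSD Toeplitz matrix $T\in\mathbb{R}^{d\times d}$, any $0<\delta<1$ and any integer $k\le d$, there exists a symmetric Toeplitz matrix $\widetilde T\in\mathbb{R}^{d\times d}$ of rank $\widetilde O(k\log(1/\delta))$ such that $$\|T-\widetilde T\|_2\le \widetilde O(1)\,\|T-T_k\|_2+\delta\|T\|_F,$$ where $T_k=\arg\min_{B:\operatorname{rank}(B)\le k}\|T-B\|_2$ is the best rank-$k$ approximation of $T$ in spectral norm.
   Context: A matrix is Toeplitz if it is constant along each diagonal. $\|\cdot\|_2$ is the spectral (operator) norm and $\|\cdot\|_F$ the Frobenius norm. The notation $\widetilde O(\cdot)$ hides factors polylogarithmic in $d$ (and in its argument); in particular $\widetilde O(1)$ denotes a factor that is polylogarithmic in $d$.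
   Formalization: In the rank bound, log(1/δ) is read as max(1, ln(1/δ)); without this cutoff the claim fails as δ tends to 1 (for the all-ones matrix with k = 1 the rank would have to be 0). *)

theory Defs
  imports Complex_Main "Jordan_Normal_Form.DL_Rank"
begin

definition toeplitz :: "'a mat \<Rightarrow> bool" where
  "toeplitz A \<longleftrightarrow>
    (\<forall>i<dim_row A. \<forall>j<dim_col A. \<forall>i'<dim_row A. \<forall>j'<dim_col A.
      int i - int j = int i' - int j' \<longrightarrow> A $$ (i, j) = A $$ (i', j'))"

definition symmetric_mat :: "'a mat \<Rightarrow> bool" where
  "symmetric_mat A \<longleftrightarrow> transpose_mat A = A"

definition psd_mat :: "real mat \<Rightarrow> bool" where
  "psd_mat A \<longleftrightarrow>
    symmetric_mat A \<and> (\<forall>x \<in> carrier_vec (dim_col A). 0 \<le> x \<bullet> (A *\<^sub>v x))"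

definition vec_norm2 :: "real vec \<Rightarrow> real" where
  "vec_norm2 x = sqrt (x \<bullet> x)"

(* The supremum is over the closed unit ball rather than the unit sphere, so that the
   set is nonempty in every dimension, including 0. *)
definition spectral_norm :: "real mat \<Rightarrow> real" where
  "spectral_norm A =
    (SUP x \<in> {x \<in> carrier_vec (dim_col A). vec_norm2 x \<le> 1}. vec_norm2 (A *\<^sub>v x))"

definition frobenius_norm :: "real mat \<Rightarrow> real" where
  "frobenius_norm A = sqrt (\<Sum>i<dim_row A. \<Sum>j<dim_col A. (A $$ (i, j))\<^sup>2)"

(* T' is a best approximation of the d x d matrix T, in spectral norm, among the real
   d x d matrices of rank at most k.  Minimizers need not be unique. *)
definition best_rank_approx :: "nat \<Rightarrow> nat \<Rightarrow> real mat \<Rightarrow> real mat \<Rightarrow> bool" where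
  "best_rank_approx d k T T' \<longleftrightarrow>
    is_arg_min (\<lambda>B. spectral_norm (T - B))
      (\<lambda>B. B \<in> carrier_mat d d \<and> vec_space.rank d B \<le> k) T'"

(* The quantities that are soft-O of f in dimension d are those bounded by soft_O C a d f
   for constants C and a that do not depend on d, f or any other parameter.  The shifts by 1
   keep the logarithmic factors at least 1 for small d and f. *)
definition soft_O :: "real \<Rightarrow> nat \<Rightarrow> nat \<Rightarrow> real \<Rightarrow> real" where
  "soft_O C a d f = C * f * (1 + ln (1 + real d)) ^ a * (1 + ln (1 + f)) ^ a"

end

theory Submission
  imports Defs "HOL-Analysis.L2_Norm"
begin

text \<open>
  After adding a small multiple of the identity, \<open>T\<close> is positive definite, so it extends to positive
  definite Toeplitz matrices of arbitrarily large size, and the Fejer means of a large extension are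
  nonnegative. Sampling them gives nonnegative weights on a fine grid of
  frequencies whose cosine moments are as close as we like to the entries of \<open>T\<close>.

  Cut the circle into \<open>16 d\<close> buckets. By a large sieve inequality the buckets of mass at most
  \<open>\<tau>\<close> contribute a matrix of norm \<open>O(\<tau> d)\<close>, so they may be dropped when \<open>\<tau>\<close> is a multiple of
  \<open>\<parallel>T - T\<^sub>k\<parallel> / d\<close>. There are only \<open>O(k)\<close> heavier buckets: on the kernel of \<open>T\<^sub>k\<close> the form of \<open>T\<close> is
  at most \<open>\<parallel>T - T\<^sub>k\<parallel>\<close>, whereas the sinusoids at the heavy buckets see mass \<open>\<tau>\<close> each, and projecting
  them to that kernel costs, by Parseval, a trace of order \<open>k\<close> only. Finally, the entries contributed
  by one bucket are a modulation of a function of \<open>i - j\<close> that varies slowly over the whole range, and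
  truncating its Taylor series gives a Toeplitz matrix whose rank is the number of terms.
\<close>

section \<open>Trigonometric polynomials and the large sieve\<close>

text \<open>The sum is the real part of a geometric sum over powers of an \<open>M\<close>-th root
  of unity \<open>z\<close>. The bound on \<open>a\<close> makes 0 the only multiple of
  \<open>M\<close> in range, so otherwise \<open>z\<close> differs from 1.\<close>

lemma sum_cos_roots:
  fixes a :: int and M :: nat
  assumes "\<bar>a\<bar> < int M"
  shows "(\<Sum>m<M. cos (2 * pi * real_of_int a * real m / real M)) = (if a = 0 then real M else 0)"
proof (cases "a = 0")
  case False
  have M: "M > 0" using assms by auto
  define z where "z = cis (2 * pi * real_of_int a / real M)"
  have zm: "z ^ m = cis (2 * pi * real_of_int a * real m / real M)" for m
    unfolding z_def Complex.DeMoivre by (simp add: algebra_simps)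
  have "z ^ M = cis (2 * pi * real_of_int a)" using M by (simp add: zm)
  also have "\<dots> = 1" by (simp add: cis_multiple_2pi)
  finally have zM: "z ^ M = 1" .
  have "z \<noteq> 1"
  proof
    assume "z = 1"
    then have "cos (2 * pi * real_of_int a / real M) = 1" by (simp add: z_def complex_eq_iff)
    then obtain n :: int where "2 * pi * real_of_int a / real M = real_of_int n * 2 * pi"
      unfolding cos_one_2pi_int by auto
    then have "real_of_int a = real_of_int (n * int M)" using M by (simp add: field_simps)
    then have "a = n * int M" by linarith
    then have "\<bar>a\<bar> = \<bar>n\<bar> * int M" by (simp add: abs_mult)
    moreover have "\<bar>n\<bar> \<ge> 1" using False \<open>a = n * int M\<close> by auto
    ultimately show False using assms M
      by (metis abs_ge_zero linorder_not_le mult_le_cancel_right1 of_nat_0_le_iff order_less_imp_not_less zero_less_abs_iff)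
  qed
  then have "(\<Sum>m<M. z ^ m) = 0" using zM by (simp add: geometric_sum)
  then have "Re (\<Sum>m<M. z ^ m) = 0" by simp
  then show ?thesis using False by (simp add: zm)
qed simp

section \<open>Real-coefficient polynomials on the unit circle\<close>

definition tpoly :: "nat \<Rightarrow> (nat \<Rightarrow> real) \<Rightarrow> real \<Rightarrow> complex" where
  "tpoly d x \<theta> = (\<Sum>j<d. of_real (x j) * cis (real j * \<theta>))"

lemma tpoly_Re: "Re (tpoly d x \<theta>) = (\<Sum>j<d. x j * cos (real j * \<theta>))"
  and tpoly_Im: "Im (tpoly d x \<theta>) = (\<Sum>j<d. x j * sin (real j * \<theta>))"
  by (simp_all add: tpoly_def)

lemma tpoly_add: "tpoly d (\<lambda>j. x j + y j) \<theta> = tpoly d x \<theta> + tpoly d y \<theta>"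
  by (simp add: tpoly_def algebra_simps sum.distrib)

text \<open>The real part pairs cosines with cosines and sines with sines, which the subtraction
  formula merges. Two different vectors are allowed because operator norms are later tested by
  bilinear forms.\<close>

lemma tpoly_inner:
  "Re (cnj (tpoly d y \<theta>) * tpoly d x \<theta>)
    = (\<Sum>i<d. \<Sum>j<d. y i * cos ((real i - real j) * \<theta>) * x j)"
proof -
  have "Re (cnj (tpoly d y \<theta>) * tpoly d x \<theta>)
      = Re (tpoly d y \<theta>) * Re (tpoly d x \<theta>) + Im (tpoly d y \<theta>) * Im (tpoly d x \<theta>)" by simp
  also have "\<dots> = (\<Sum>i<d. \<Sum>j<d. y i * cos ((real i - real j) * \<theta>) * x j)"
    unfolding tpoly_Re tpoly_Im sum_product sum.distrib[symmetric]
    by (intro sum.cong refl) (simp add: left_diff_distrib cos_diff algebra_simps)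
  finally show ?thesis .
qed

lemma tpoly_norm_sq:
  "(cmod (tpoly d x \<theta>))\<^sup>2 = (\<Sum>i<d. \<Sum>j<d. x i * cos ((real i - real j) * \<theta>) * x j)"
  unfolding tpoly_inner[symmetric] cmod_power2 by (simp add: power2_eq_square)

text \<open>With \<open>d \<le> M\<close> the differences \<open>i - j\<close> stay strictly between
  \<open>- M\<close> and \<open>M\<close>, so sampling at \<open>M\<close> points causes no aliasing
  and only the diagonal survives.\<close>

lemma tpoly_parseval:
  assumes "d \<le> M"
  shows "(\<Sum>b<M. (cmod (tpoly d x (2 * pi * real b / real M)))\<^sup>2) = real M * (\<Sum>j<d. (x j)\<^sup>2)"
proof -
  have "(\<Sum>b<M. (cmod (tpoly d x (2 * pi * real b / real M)))\<^sup>2)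
     = (\<Sum>i<d. \<Sum>j<d. x i * x j * (\<Sum>b<M. cos (2 * pi * real_of_int (int i - int j) * real b / real M)))"
    unfolding tpoly_norm_sq sum_distrib_left
    by (subst sum.swap, rule sum.cong, rule refl, subst sum.swap) (simp add: mult_ac)
  also have "\<dots> = (\<Sum>i<d. \<Sum>j<d. x i * x j * (if i = j then real M else 0))"
    by (intro sum.cong refl, subst sum_cos_roots) (use assms in auto)
  also have "\<dots> = real M * (\<Sum>j<d. (x j)\<^sup>2)"
    by (simp add: sum.delta sum_distrib_left power2_eq_square mult_ac if_distrib cong: if_cong)
  finally show ?thesis .
qed

text \<open>The circle carries a grid of \<open>D * q\<close> equally spaced frequencies, grouped
  into \<open>D\<close> buckets of \<open>q\<close> consecutive points: the first summand is the
  left endpoint of bucket \<open>b\<close>, the second the offset inside it.\<close>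

definition node :: "nat \<Rightarrow> nat \<Rightarrow> nat \<Rightarrow> nat \<Rightarrow> real" where
  "node D q b r = 2 * pi * real b / real D + 2 * pi * real r / (real q * real D)"

lemma node_alt: "0 < q \<Longrightarrow> node D q b r = 2 * pi * real (b * q + r) / real (D * q)"
  by (simp add: node_def field_simps add_divide_distrib)

lemma sum_nodes:
  fixes f :: "nat \<Rightarrow> real"
  shows "(\<Sum>b<D. \<Sum>r<q. f (b * q + r)) = (\<Sum>m<D * q. f m)"
proof -
  have "(\<Sum>r<q. f (b * q + r)) = sum f {b * q..<b * q + q}" for b
    using sum.shift_bounds_nat_ivl[of f 0 "b * q" q] by (simp add: lessThan_atLeast0 add.commute)
  then show ?thesis by (simp add: sum.nat_group)
qed

text \<open>Cauchy-Schwarz with each weight split into two square roots.\<close>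

lemma weighted_square_sum:
  fixes a u :: "nat \<Rightarrow> real"
  assumes "\<And>p. p < n \<Longrightarrow> 0 \<le> a p" "\<And>p. p < n \<Longrightarrow> 0 \<le> u p"
  shows "(\<Sum>p<n. a p * u p)\<^sup>2 \<le> (\<Sum>p<n. a p) * (\<Sum>p<n. a p * (u p)\<^sup>2)"
proof -
  have "(\<Sum>p<n. a p * u p) = (\<Sum>p<n. \<bar>sqrt (a p)\<bar> * \<bar>sqrt (a p) * u p\<bar>)"
    by (intro sum.cong refl) (use assms in \<open>auto simp: mult.assoc[symmetric] abs_mult\<close>)
  also have "\<dots> \<le> L2_set (\<lambda>p. sqrt (a p)) {..<n} * L2_set (\<lambda>p. sqrt (a p) * u p) {..<n}"
    by (rule L2_set_mult_ineq)
  finally have "(\<Sum>p<n. a p * u p)\<^sup>2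
      \<le> (L2_set (\<lambda>p. sqrt (a p)) {..<n} * L2_set (\<lambda>p. sqrt (a p) * u p) {..<n})\<^sup>2"
    using assms by (intro power_mono sum_nonneg) auto
  also have "\<dots> = (\<Sum>p<n. (sqrt (a p))\<^sup>2) * (\<Sum>p<n. (sqrt (a p) * u p)\<^sup>2)"
    by (simp add: L2_set_def power_mult_distrib sum_nonneg)
  also have "\<dots> = (\<Sum>p<n. a p) * (\<Sum>p<n. a p * (u p)\<^sup>2)"
    by (intro arg_cong2[where f = "(*)"] sum.cong refl) (use assms in \<open>auto simp: power_mult_distrib\<close>)
  finally show ?thesis .
qed

text \<open>The offset inside a bucket is expanded into a Taylor series, so that only the bucket
  endpoints, to which Parseval applies, remain.\<close>

lemma large_sieve:
  assumes q: "0 < q" and D: "16 * d \<le> D" "0 < D"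
    and w: "\<And>b r. 0 \<le> w b r" and mass: "\<And>b. b < D \<Longrightarrow> (\<Sum>r<q. w b r) \<le> \<tau>"
  shows "(\<Sum>b<D. \<Sum>r<q. w b r * (cmod (tpoly d x (node D q b r)))\<^sup>2)
    \<le> 9 * real D * \<tau> * (\<Sum>j<d. (x j)\<^sup>2)"
proof (cases "d = 0")
  case True
  then show ?thesis by (simp add: tpoly_def)
next
  case False
  then have d: "d > 0" by simp
  define g where "g r = 2 * pi * real r / (real q * real D)" for r
  \<comment> \<open>The phase \<open>j * g r\<close> is written as
    \<open>(g r * d) * (j / d)\<close>: powers of \<open>j / d\<close> stay in [0, 1], so Parseval
    bounds every \<open>X p\<close> by the same energy.\<close>
  define X where "X p b = tpoly d (\<lambda>j. x j * (real j / real d) ^ p) (2 * pi * real b / real D)" for p b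
  define S where "S n b r = (\<Sum>p<n. (\<i> * of_real (g r * real d)) ^ p / of_nat (fact p) * X p b)" for n b r
  define a :: "nat \<Rightarrow> real" where "a p = 1 / fact p" for p
  have g01: "0 \<le> g r \<and> g r * real d \<le> 1" if "r < q" for r
  proof -
    \<comment> \<open>\<open>pi < 4\<close> and \<open>16 * d \<le> D\<close> suffice for the
      largest phase shift inside a bucket to be at most 1.\<close>
    have "2 * pi * (real r * real d) \<le> 8 * (real q * real d)"
      using that pi_less_4 by (intro mult_mono) auto
    also have "\<dots> \<le> real q * real D"
      using mult_left_mono[of "real (8 * d)" "real D" "real q"] D by (simp add: algebra_simps)
    finally show ?thesis using q D by (simp add: g_def field_simps)
  qed
  have lim: "(\<lambda>n. S n b r) \<longlonglongrightarrow> tpoly d x (node D q b r)" for b r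
  proof -
    have "(\<lambda>n. \<Sum>j<d. of_real (x j) * cis (real j * (2 * pi * real b / real D)) *
         (\<Sum>p<n. (\<i> * of_real (real j * g r)) ^ p /\<^sub>R fact p)) \<longlonglongrightarrow>
       (\<Sum>j<d. of_real (x j) * cis (real j * (2 * pi * real b / real D)) * exp (\<i> * of_real (real j * g r)))"
      using exp_converges[of "\<i> * of_real (real _ * g r) :: complex"]
      by (intro tendsto_sum tendsto_mult tendsto_const) (simp add: sums_def)
    moreover have "(\<Sum>j<d. of_real (x j) * cis (real j * (2 * pi * real b / real D)) *
         (\<Sum>p<n. (\<i> * of_real (real j * g r)) ^ p /\<^sub>R fact p)) = S n b r" for n
      unfolding S_def X_def tpoly_def sum_distrib_left
      by (subst sum.swap, intro sum.cong refl)
         (use d in \<open>simp add: scaleR_conv_of_real power_mult_distrib power_divide field_simps\<close>)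
    moreover have "(\<Sum>j<d. of_real (x j) * cis (real j * (2 * pi * real b / real D)) * exp (\<i> * of_real (real j * g r)))
       = tpoly d x (node D q b r)"
      unfolding tpoly_def
      by (intro sum.cong refl)
         (simp add: cis_conv_exp mult.assoc mult_exp_exp node_def g_def algebra_simps)
    ultimately show ?thesis by simp
  qed
  have asum: "(\<Sum>p<n. a p) \<le> 3" for n
  proof -
    have "(\<Sum>p<n. a p) \<le> exp 1"
      using exp_converges[of "1::real"] unfolding a_def
      by (intro sum_le_suminf[THEN order_trans])
         (auto simp: sums_iff divide_inverse)
    then show ?thesis using exp_le by linarith
  qed
  \<comment> \<open>Cauchy-Schwarz with the weights \<open>1 / fact p\<close>, whose total is at
    most \<open>exp 1 \<le> 3\<close>.\<close>
  have S: "(cmod (S n b r))\<^sup>2 \<le> 3 * (\<Sum>p<n. a p * (cmod (X p b))\<^sup>2)" if "r < q" for n b r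
  proof -
    have "cmod (S n b r) \<le> (\<Sum>p<n. a p * cmod (X p b))"
      unfolding S_def
    proof (rule sum_norm_le)
      fix p
      have "(\<bar>g r\<bar> * real d) ^ p \<le> 1" using g01[OF that] by (intro power_le_one) auto
      then have "(\<bar>g r\<bar> * real d) ^ p * (cmod (X p b) / fact p) \<le> 1 * (cmod (X p b) / fact p)"
        by (intro mult_right_mono) auto
      then show "cmod ((\<i> * of_real (g r * real d)) ^ p / of_nat (fact p) * X p b) \<le> a p * cmod (X p b)"
        by (simp add: a_def norm_mult norm_divide norm_power abs_mult)
    qed
    then have "(cmod (S n b r))\<^sup>2 \<le> (\<Sum>p<n. a p * cmod (X p b))\<^sup>2" by (intro power_mono) auto
    also have "\<dots> \<le> (\<Sum>p<n. a p) * (\<Sum>p<n. a p * (cmod (X p b))\<^sup>2)"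
      by (rule weighted_square_sum) (simp_all add: a_def)
    also have "\<dots> \<le> 3 * (\<Sum>p<n. a p * (cmod (X p b))\<^sup>2)"
      by (intro mult_right_mono asum sum_nonneg) (simp add: a_def)
    finally show ?thesis .
  qed
  have tau: "\<tau> \<ge> 0"
    using mass[of 0] D w by (meson order_trans sum_nonneg)
  have X: "(\<Sum>b<D. (cmod (X p b))\<^sup>2) \<le> real D * (\<Sum>j<d. (x j)\<^sup>2)" for p
  proof -
    have "(\<Sum>b<D. (cmod (X p b))\<^sup>2) = real D * (\<Sum>j<d. (x j * (real j / real d) ^ p)\<^sup>2)"
      unfolding X_def using D d by (intro tpoly_parseval) auto
    also have "\<dots> \<le> real D * (\<Sum>j<d. (x j)\<^sup>2 * 1)"
      unfolding power_mult_distrib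
      by (intro mult_left_mono sum_mono power_le_one) auto
    finally show ?thesis by simp
  qed
  \<comment> \<open>The 9 is 3 times 3: the weights \<open>a\<close> are summed once in
    Cauchy-Schwarz and once more over the Parseval bounds.\<close>
  have bound: "(\<Sum>b<D. \<Sum>r<q. w b r * (cmod (S n b r))\<^sup>2) \<le> 9 * real D * \<tau> * (\<Sum>j<d. (x j)\<^sup>2)" for n
  proof -
    have "(\<Sum>b<D. \<Sum>r<q. w b r * (cmod (S n b r))\<^sup>2)
      \<le> (\<Sum>b<D. \<Sum>r<q. w b r * (3 * (\<Sum>p<n. a p * (cmod (X p b))\<^sup>2)))"
      by (intro sum_mono mult_left_mono S w) auto
    also have "\<dots> = (\<Sum>b<D. (\<Sum>r<q. w b r) * (3 * (\<Sum>p<n. a p * (cmod (X p b))\<^sup>2)))"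
      by (simp add: sum_distrib_right)
    also have "\<dots> \<le> (\<Sum>b<D. \<tau> * (3 * (\<Sum>p<n. a p * (cmod (X p b))\<^sup>2)))"
      by (intro sum_mono mult_right_mono mass mult_nonneg_nonneg sum_nonneg) (auto simp: a_def)
    also have "\<dots> = 3 * \<tau> * (\<Sum>p<n. a p * (\<Sum>b<D. (cmod (X p b))\<^sup>2))"
      by (simp add: sum_distrib_left sum.swap[of _ "{..<n}"] mult_ac)
    also have "\<dots> \<le> 3 * \<tau> * (\<Sum>p<n. a p * (real D * (\<Sum>j<d. (x j)\<^sup>2)))"
      using tau by (intro mult_left_mono sum_mono X) (auto simp: a_def)
    also have "\<dots> = 3 * \<tau> * ((\<Sum>p<n. a p) * (real D * (\<Sum>j<d. (x j)\<^sup>2)))"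
      by (simp add: sum_distrib_right)
    also have "\<dots> \<le> 3 * \<tau> * (3 * (real D * (\<Sum>j<d. (x j)\<^sup>2)))"
      using tau by (intro mult_left_mono mult_right_mono asum mult_nonneg_nonneg sum_nonneg) auto
    finally show ?thesis by (simp add: mult_ac)
  qed
  \<comment> \<open>The bound does not depend on the truncation order and so survives the
    limit.\<close>
  have "(\<lambda>n. \<Sum>b<D. \<Sum>r<q. w b r * (cmod (S n b r))\<^sup>2) \<longlonglongrightarrow>
     (\<Sum>b<D. \<Sum>r<q. w b r * (cmod (tpoly d x (node D q b r)))\<^sup>2)"
    by (intro tendsto_intros lim)
  then show ?thesis by (rule LIMSEQ_le_const2) (use bound in auto)
qed

section \<open>Positive Toeplitz forms as cosine moments\<close>

text \<open>A nonzero kernel vector would make the form vanish, so positivity forces a nonzero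
  determinant and the system is solvable.\<close>

lemma pos_def_solve:
  fixes S :: "nat \<Rightarrow> nat \<Rightarrow> real"
  assumes pos: "\<And>x. \<exists>i<n. x i \<noteq> 0 \<Longrightarrow> 0 < (\<Sum>i<n. \<Sum>j<n. x i * S i j * x j)"
  obtains a where "\<And>i. i < n \<Longrightarrow> (\<Sum>j<n. S i j * a j) = r i"
proof -
  define A where "A = mat n n (\<lambda>(i, j). S i j)"
  have A: "A \<in> carrier_mat n n" by (simp add: A_def)
  have mv: "(A *\<^sub>v v) $ i = (\<Sum>j<n. S i j * v $ j)" if "v \<in> carrier_vec n" "i < n" for v i
    using that by (auto simp: A_def scalar_prod_def lessThan_atLeast0 intro!: sum.cong)
  have "det A \<noteq> 0"
  proof
    assume "det A = 0"
    then obtain v where v: "v \<in> carrier_vec n" "v \<noteq> 0\<^sub>v n" "A *\<^sub>v v = 0\<^sub>v n"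
      using det_0_iff_vec_prod_zero_field[OF A] by blast
    have "(\<Sum>i<n. \<Sum>j<n. v $ i * S i j * v $ j) = (\<Sum>i<n. v $ i * (A *\<^sub>v v) $ i)"
      using v(1) by (simp add: mv sum_distrib_left mult.assoc)
    also have "\<dots> = 0" by (simp add: v(3))
    finally have "\<not> (\<exists>i<n. v $ i \<noteq> 0)" using pos[of "\<lambda>i. v $ i"] by auto
    then have "v = 0\<^sub>v n" using v(1) by (intro eq_vecI) auto
    then show False using v(2) by simp
  qed
  from det_non_zero_imp_unit[OF A this, of "()"] obtain B where B: "B \<in> carrier_mat n n" "A * B = 1\<^sub>m n"
    unfolding Units_def by (auto simp: ring_mat_def)
  define a where "a = B *\<^sub>v vec n r"
  have a: "a \<in> carrier_vec n" using B by (simp add: a_def)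
  have "A *\<^sub>v a = vec n r"
    unfolding a_def using A B by (simp add: assoc_mult_mat_vec[symmetric])
  then show ?thesis using that[of "\<lambda>i. a $ i"] mv[OF a] by auto
qed

section \<open>Extending positive definite Toeplitz forms\<close>

text \<open>A symmetric Toeplitz matrix is stored as its first column \<open>t\<close>, its entries
  being \<open>t (gap i j)\<close>.\<close>

definition gap :: "nat \<Rightarrow> nat \<Rightarrow> nat" where
  "gap i j = nat \<bar>int i - int j\<bar>"

lemma gap_simps [simp]:
  "gap i i = 0" "gap 0 j = j" "gap i 0 = i" "gap (Suc i) (Suc j) = gap i j"
  by (auto simp: gap_def)

lemma gap_sym: "gap i j = gap j i"
  by (simp add: gap_def)

lemma gap_less: "i < n \<Longrightarrow> j < n \<Longrightarrow> gap i j < n"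
  by (auto simp: gap_def)

lemma cos_gap: "cos (real (gap i j) * \<theta>) = cos ((real i - real j) * \<theta>)"
proof (cases "i \<le> j")
  case True
  then have "real (gap i j) * \<theta> = - ((real i - real j) * \<theta>)" by (simp add: gap_def algebra_simps of_nat_diff)
  then show ?thesis by (metis cos_minus)
qed (simp add: gap_def)

text \<open>Strict positivity is asked for because the extension step solves linear systems with the
  leading block.\<close>

definition pos_toep :: "nat \<Rightarrow> (nat \<Rightarrow> real) \<Rightarrow> bool" where
  "pos_toep n t \<longleftrightarrow>
    (\<forall>x. (\<exists>i<n. x i \<noteq> 0) \<longrightarrow> 0 < (\<Sum>i<n. \<Sum>j<n. x i * t (gap i j) * x j))"

lemma pos_toepD:
  "pos_toep n t \<Longrightarrow> \<exists>i<n. x i \<noteq> 0 \<Longrightarrow> 0 < (\<Sum>i<n. \<Sum>j<n. x i * t (gap i j) * x j)"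
  by (simp add: pos_toep_def)

lemma sum_ends: "(\<Sum>i<Suc (Suc m). f i) = f 0 + (\<Sum>i<m. f (Suc i)) + (f (Suc m) :: real)"
  unfolding sum.lessThan_Suc[of f "Suc m"] sum.lessThan_Suc_shift[of f m] by simp

text \<open>The new diagonal is the central extension: with \<open>S\<close> the shared block, \<open>S a\<close> and \<open>S b\<close> the
  two border columns, completing the square leaves two decoupled positive Schur complements.\<close>

lemma pos_toep_extend:
  assumes pos: "pos_toep (Suc m) t"
  shows "\<exists>c. pos_toep (Suc (Suc m)) (t(Suc m := c))"
proof -
  \<comment> \<open>\<open>G\<close> is the form of the block shared by the two overlapping windows
    of size \<open>Suc m\<close>; \<open>R\<close> and \<open>V\<close> pair a vector with the first
    and the last border column.\<close>
  define G where "G x y = (\<Sum>i<m. \<Sum>j<m. x i * t (gap i j) * y j)" for x y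
  define R where "R u = (\<Sum>i<m. t (Suc i) * u i)" for u
  define V where "V u = (\<Sum>i<m. t (m - i) * u i)" for u
  have G_add: "G (\<lambda>i. x i + y i) z = G x z + G y z" for x y z
    by (simp add: G_def distrib_right sum.distrib)
  have G_mult: "G (\<lambda>i. k * x i) z = k * G x z" for k x z
    by (simp add: G_def sum_distrib_left mult.assoc)
  have G_sym: "G x y = G y x" for x y
    unfolding G_def by (subst sum.swap) (simp add: gap_sym mult_ac)
  have G_add2: "G z (\<lambda>i. x i + y i) = G z x + G z y" for x y z
    by (simp only: G_sym[of z] G_add)
  have G_mult2: "G z (\<lambda>i. k * x i) = k * G z x" for k x z
    by (simp only: G_sym[of z] G_mult)
  have Gpos: "0 < G x x" if "\<exists>i<m. x i \<noteq> 0" for x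
  proof -
    have "\<exists>i<Suc m. (if i < m then x i else 0) \<noteq> 0" using that less_Suc_eq by auto
    then have "0 < (\<Sum>i<Suc m. \<Sum>j<Suc m. (if i < m then x i else 0) * t (gap i j) * (if j < m then x j else 0))"
      by (rule pos_toepD[OF pos])
    then show ?thesis by (simp add: G_def)
  qed
  have Gnn: "0 \<le> G x x" for x
    using Gpos[of x] by (cases "\<exists>i<m. x i \<noteq> 0") (auto simp: G_def)
  obtain a where a: "\<And>i. i < m \<Longrightarrow> (\<Sum>j<m. t (gap i j) * a j) = t (Suc i)"
    using pos_def_solve[of m "\<lambda>i j. t (gap i j)" "\<lambda>i. t (Suc i)"] Gpos unfolding G_def by blast
  obtain b where b: "\<And>i. i < m \<Longrightarrow> (\<Sum>j<m. t (gap i j) * b j) = t (m - i)"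
    using pos_def_solve[of m "\<lambda>i j. t (gap i j)" "\<lambda>i. t (m - i)"] Gpos unfolding G_def by blast
  have Ga: "G u a = R u" for u
  proof -
    have "G u a = (\<Sum>i<m. u i * (\<Sum>j<m. t (gap i j) * a j))"
      by (simp add: G_def sum_distrib_left mult.assoc)
    then show ?thesis by (simp add: a R_def mult.commute[of "u _"])
  qed
  have Gb: "G u b = V u" for u
  proof -
    have "G u b = (\<Sum>i<m. u i * (\<Sum>j<m. t (gap i j) * b j))"
      by (simp add: G_def sum_distrib_left mult.assoc)
    then show ?thesis by (simp add: b V_def mult.commute[of "u _"])
  qed
  \<comment> \<open>The form at the vector \<open>(1, - a)\<close> is the Schur complement of the
    shared block in the first window.\<close>
  have ka: "0 < t 0 - R a"
  proof -
    define x where "x i = (case i of 0 \<Rightarrow> 1 | Suc j \<Rightarrow> - a j)" for i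
    have "0 < (\<Sum>i<Suc m. \<Sum>j<Suc m. x i * t (gap i j) * x j)"
      by (rule pos_toepD[OF pos]) (auto simp: x_def)
    also have "\<dots> = t 0 - R a - R a + G a a"
      unfolding sum.lessThan_Suc_shift
      by (simp add: x_def R_def G_def sum.distrib sum_negf mult_ac sum_subtractf)
    finally show ?thesis by (simp add: Ga)
  qed
  \<comment> \<open>Likewise for the last window, at the vector \<open>(- b, 1)\<close>.\<close>
  have kb: "0 < t 0 - V b"
  proof -
    define x where "x i = (if i < m then - b i else 1)" for i
    have gm: "gap i m = m - i" "gap m i = m - i" if "i < m" for i using that by (auto simp: gap_def)
    have "0 < (\<Sum>i<Suc m. \<Sum>j<Suc m. x i * t (gap i j) * x j)"
      by (rule pos_toepD[OF pos]) (auto simp: x_def)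
    also have "\<dots> = t 0 - V b - V b + G b b"
      by (simp add: x_def V_def G_def gm sum.distrib sum_negf sum_subtractf mult_ac)
    finally show ?thesis by (simp add: Gb)
  qed
  \<comment> \<open>Since \<open>G a b = V a\<close>, this value makes the cross term of the
    completed square equal to the corner contribution, so no mixed term is left over.\<close>
  define c where "c = V a"
  have Rb: "R b = c" using G_sym[of a b] by (simp add: Ga Gb c_def)
  let ?t = "t(Suc m := c)"
  have "pos_toep (Suc (Suc m)) ?t"
    unfolding pos_toep_def
  proof (intro allI impI)
    fix x :: "nat \<Rightarrow> real"
    assume x: "\<exists>i<Suc (Suc m). x i \<noteq> 0"
    let ?\<alpha> = "x 0" and ?\<beta> = "x (Suc m)"
    define u where "u i = x (Suc i)" for i
    have gm: "gap i m = m - i" "gap m i = m - i" if "i < m" for i using that by (auto simp: gap_def)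
    \<comment> \<open>The new entry \<open>c\<close> occurs only in the two far corners.\<close>
    have gn: "gap i j \<noteq> Suc m" if "i < m" "j < m" for i j using gap_less[OF that] by simp
    have gs: "m - i \<noteq> Suc m" for i by simp
    have border:
      "(\<Sum>j<m. ?\<alpha> * t (Suc j) * u j) = ?\<alpha> * R u" "(\<Sum>i<m. u i * t (Suc i) * ?\<alpha>) = ?\<alpha> * R u"
      "(\<Sum>j<m. ?\<beta> * t (m - j) * u j) = ?\<beta> * V u" "(\<Sum>i<m. u i * t (m - i) * ?\<beta>) = ?\<beta> * V u"
      by (simp_all add: R_def V_def sum_distrib_left mult_ac)
    have "(\<Sum>i<Suc (Suc m). \<Sum>j<Suc (Suc m). x i * ?t (gap i j) * x j)
      = ?\<alpha> * t 0 * ?\<alpha> + (\<Sum>j<m. ?\<alpha> * t (Suc j) * u j) + ?\<alpha> * c * ?\<beta>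
        + ((\<Sum>i<m. u i * t (Suc i) * ?\<alpha>) + G u u + (\<Sum>i<m. u i * t (m - i) * ?\<beta>))
        + (?\<beta> * c * ?\<alpha> + (\<Sum>j<m. ?\<beta> * t (m - j) * u j) + ?\<beta> * t 0 * ?\<beta>)"
      unfolding sum_ends by (simp add: gm gn gs sum.distrib u_def G_def)
    also have "\<dots> = ?\<alpha>\<^sup>2 * t 0 + ?\<beta>\<^sup>2 * t 0 + 2 * ?\<alpha> * R u + 2 * ?\<beta> * V u + 2 * ?\<alpha> * ?\<beta> * c + G u u"
      unfolding border by (simp add: power2_eq_square)
    also have "\<dots> = G (\<lambda>i. (u i + ?\<alpha> * a i) + ?\<beta> * b i) (\<lambda>i. (u i + ?\<alpha> * a i) + ?\<beta> * b i)
        + ?\<alpha>\<^sup>2 * (t 0 - R a) + ?\<beta>\<^sup>2 * (t 0 - V b)"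
      by (simp only: G_add G_mult G_add2 G_mult2 Ga Gb G_sym[of a u] G_sym[of b u] Rb c_def[symmetric])
        (simp add: power2_eq_square algebra_simps)
    also have "\<dots> > 0"
    proof (cases "?\<alpha> = 0 \<and> ?\<beta> = 0")
      case True
      obtain i where "i < Suc (Suc m)" "x i \<noteq> 0" using x by blast
      with True obtain i' where "i = Suc i'" "i' < m" by (cases i) (auto simp: less_Suc_eq)
      with \<open>x i \<noteq> 0\<close> have "\<exists>i<m. u i \<noteq> 0" by (auto simp: u_def)
      then show ?thesis using True Gpos[of u] by simp
    next
      case False
      then have "0 < ?\<alpha>\<^sup>2 * (t 0 - R a) + ?\<beta>\<^sup>2 * (t 0 - V b)"
        using ka kb by (cases "?\<alpha> = 0") (auto intro!: add_pos_nonneg)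
      then show ?thesis
          using Gnn[of "\<lambda>i. (u i + ?\<alpha> * a i) + ?\<beta> * b i"] by linarith
    qed
    finally show "0 < (\<Sum>i<Suc (Suc m). \<Sum>j<Suc (Suc m). x i * ?t (gap i j) * x j)" .
  qed
  then show ?thesis by blast
qed

lemma pos_toep_extension:
  assumes "pos_toep n t" "0 < n" "n \<le> N"
  shows "\<exists>t'. pos_toep N t' \<and> (\<forall>i<n. t' i = t i)"
  using assms(3)
proof (induction N rule: dec_induct)
  case base
  then show ?case using assms by blast
next
  case (step m)
  then obtain t' where t': "pos_toep m t'" "\<forall>i<n. t' i = t i" by blast
  from step assms(2) obtain m' where "m = Suc m'" by (cases m) auto
  with pos_toep_extend[of m' t'] t'(1) obtain c where "pos_toep (Suc m) (t'(m := c))" by auto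
  moreover have "\<forall>i<n. (t'(m := c)) i = t i" using t'(2) step by auto
  ultimately show ?case by blast
qed

lemma pos_toep_nonneg:
  assumes "pos_toep n t"
  shows "0 \<le> (\<Sum>i<n. \<Sum>j<n. x i * t (gap i j) * x j)"
proof (cases "\<exists>i<n. x i \<noteq> 0")
  case True
  then show ?thesis using pos_toepD[OF assms] by (simp add: less_imp_le)
qed simp

section \<open>Fejer means sampled on a grid\<close>

text \<open>This diagonal has \<open>N - n\<close> entries, the source of the Fejer factor
  \<open>1 - n / N\<close>.\<close>

lemma sum_diagonal:
  fixes t :: "nat \<Rightarrow> real"
  assumes "n \<le> N"
  shows "(\<Sum>i<N. \<Sum>j<N. t (gap i j) * (if j = i + n then 1 else 0)) = (real N - real n) * t n"
proof -
  have g: "gap i (i + n) = n" for i by (simp add: gap_def)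
  have "(\<Sum>i<N. \<Sum>j<N. t (gap i j) * (if j = i + n then 1 else 0))
      = (\<Sum>i<N. if i + n < N then t n else 0)"
    by (intro sum.cong refl) (simp add: if_distrib[where f = "\<lambda>z. _ * z"] sum.delta g cong: if_cong)
  also have "\<dots> = (\<Sum>i | i < N \<and> i + n < N. t n)"
    by (simp add: sum.inter_filter[symmetric])
  also have "{i. i < N \<and> i + n < N} = {..<N - n}" by auto
  finally show ?thesis using assms by (simp add: of_nat_diff)
qed

text \<open>\<open>w\<close> samples the Fejer mean of \<open>t\<close>. The cosine of a difference
  splits it into the form at a cosine vector plus the form at a sine vector, hence positivity. For
  the moments, the frequencies \<open>i - j + n\<close> and \<open>i - j - n\<close> are below
  \<open>M\<close> in absolute value because \<open>N + d \<le> M\<close>, so only two diagonals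
  contribute.\<close>

lemma fejer_weights:
  assumes pos: "pos_toep N t" and "0 < N" "d \<le> N" "N + d \<le> M"
  defines "w \<equiv> \<lambda>m. (\<Sum>i<N. \<Sum>j<N. t (gap i j) * cos ((real i - real j) * (2 * pi * real m / real M)))
     / (real M * real N)"
  shows "0 \<le> w m"
    and "n < d \<Longrightarrow> (\<Sum>m<M. w m * cos (real n * (2 * pi * real m / real M))) = (1 - real n / real N) * t n"
proof -
  have split: "(\<Sum>i<N. \<Sum>j<N. t (gap i j) * cos ((real i - real j) * \<theta>))
     = (\<Sum>i<N. \<Sum>j<N. cos (real i * \<theta>) * t (gap i j) * cos (real j * \<theta>))
     + (\<Sum>i<N. \<Sum>j<N. sin (real i * \<theta>) * t (gap i j) * sin (real j * \<theta>))" for \<theta>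
    unfolding sum.distrib[symmetric]
    by (intro sum.cong refl) (simp add: left_diff_distrib cos_diff algebra_simps)
  show "0 \<le> w m"
    unfolding w_def split
    by (intro divide_nonneg_nonneg add_nonneg_nonneg pos_toep_nonneg[OF pos]) auto
  assume n: "n < d"
  define \<theta> where "\<theta> m = 2 * pi * real m / real M" for m
  have prod: "(\<Sum>m<M. cos ((real i - real j) * \<theta> m) * cos (real n * \<theta> m))
     = real M / 2 * ((if j = i + n then 1 else 0) + (if i = j + n then 1 else 0))"
    if ij: "i < N" "j < N" for i j
  proof -
    have "cos ((real i - real j) * \<theta> m) * cos (real n * \<theta> m)
      = (cos (2 * pi * real_of_int (int i - int j + int n) * real m / real M)
        + cos (2 * pi * real_of_int (int i - int j - int n) * real m / real M)) / 2" for m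
    proof -
      have "2 * pi * real_of_int (int i - int j + int n) * real m / real M = (real i - real j) * \<theta> m + real n * \<theta> m"
        "2 * pi * real_of_int (int i - int j - int n) * real m / real M = (real i - real j) * \<theta> m - real n * \<theta> m"
        by (simp_all add: \<theta>_def algebra_simps add_divide_distrib diff_divide_distrib)
      then show ?thesis by (simp add: cos_times_cos)
    qed
    from this have "(\<Sum>m<M. cos ((real i - real j) * \<theta> m) * cos (real n * \<theta> m))
      = ((\<Sum>m<M. cos (2 * pi * real_of_int (int i - int j + int n) * real m / real M))
        + (\<Sum>m<M. cos (2 * pi * real_of_int (int i - int j - int n) * real m / real M))) / 2"
      by (simp only: sum.distrib sum_divide_distrib add_divide_distrib)
    also have "\<dots> = real M / 2 * ((if j = i + n then 1 else 0) + (if i = j + n then 1 else 0))"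
      using ij n assms by (subst (1 2) sum_cos_roots) auto
    finally show ?thesis .
  qed
  have M: "M > 0" using assms by simp
  have "(\<Sum>m<M. w m * cos (real n * \<theta> m))
     = (\<Sum>m<M. \<Sum>i<N. \<Sum>j<N. t (gap i j) * (cos ((real i - real j) * \<theta> m) * cos (real n * \<theta> m)))
       / (real M * real N)"
    by (simp add: w_def \<theta>_def sum_divide_distrib sum_distrib_right mult.assoc)
  also have "(\<Sum>m<M. \<Sum>i<N. \<Sum>j<N. t (gap i j) * (cos ((real i - real j) * \<theta> m) * cos (real n * \<theta> m)))
     = (\<Sum>i<N. \<Sum>j<N. t (gap i j) * (\<Sum>m<M. cos ((real i - real j) * \<theta> m) * cos (real n * \<theta> m)))"
    unfolding sum_distrib_left
    by (subst sum.swap, rule sum.cong, rule refl, subst sum.swap) (rule refl)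
  also have "\<dots> = (\<Sum>i<N. \<Sum>j<N. t (gap i j) * (real M / 2 * ((if j = i + n then 1 else 0) + (if i = j + n then 1 else 0))))"
    by (intro sum.cong refl arg_cong2[where f = "(*)"] prod) auto
  also have "\<dots> = real M / 2 * ((\<Sum>i<N. \<Sum>j<N. t (gap i j) * (if j = i + n then 1 else 0))
      + (\<Sum>i<N. \<Sum>j<N. t (gap i j) * (if i = j + n then 1 else 0)))"
    unfolding sum.distrib[symmetric] sum_distrib_left
    by (intro sum.cong refl) (simp add: algebra_simps)
  also have "(\<Sum>i<N. \<Sum>j<N. t (gap i j) * (if i = j + n then 1 else 0))
      = (\<Sum>i<N. \<Sum>j<N. t (gap i j) * (if j = i + n then 1 else 0))"
    by (subst sum.swap) (simp add: gap_sym)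
  also have "\<dots> = (real N - real n) * t n" using n assms by (intro sum_diagonal) auto
  also have "real M / 2 * ((real N - real n) * t n + (real N - real n) * t n) / (real M * real N)
      = (1 - real n / real N) * t n"
    using M \<open>0 < N\<close> by (simp add: field_simps)
  finally show "(\<Sum>m<M. w m * cos (real n * (2 * pi * real m / real M))) = (1 - real n / real N) * t n"
    by (simp only: \<theta>_def)
qed

text \<open>The error is shared equally: \<open>\<eta> / 2\<close> added on the diagonal buys
  definiteness, and \<open>\<eta> / 2\<close> absorbs the Fejer factor once the extension is
  large.\<close>

lemma psd_toeplitz_approx_moments:
  assumes psd: "\<And>x. 0 \<le> (\<Sum>i<d. \<Sum>j<d. x i * t (gap i j) * x j)"
    and "0 < d" "0 < \<eta>" "0 < D"
  shows "\<exists>q w. 0 < q \<and> (\<forall>b r. 0 \<le> w b r) \<and>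
    (\<forall>n<d. \<bar>(\<Sum>b<D. \<Sum>r<q. w b r * cos (real n * node D q b r)) - t n\<bar> \<le> \<eta>)"
proof -
  define t1 where "t1 = t(0 := t 0 + \<eta> / 2)"
  have "pos_toep d t1"
    unfolding pos_toep_def
  proof (intro allI impI)
    fix x assume x: "\<exists>i<d. x i \<noteq> (0::real)"
    have t1: "t1 (gap i j) = t (gap i j) + (if i = j then \<eta> / 2 else 0)" for i j
      by (auto simp: t1_def gap_def)
    have "x i * t1 (gap i j) * x j = x i * t (gap i j) * x j + (if j = i then \<eta> / 2 * (x i)\<^sup>2 else 0)" for i j
      by (simp add: t1 algebra_simps power2_eq_square)
    then have "(\<Sum>i<d. \<Sum>j<d. x i * t1 (gap i j) * x j)
       = (\<Sum>i<d. \<Sum>j<d. x i * t (gap i j) * x j) + \<eta> / 2 * (\<Sum>i<d. (x i)\<^sup>2)"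
      by (simp add: sum.distrib sum.delta sum_distrib_left)
    moreover have "0 < (\<Sum>i<d. (x i)\<^sup>2)" using x by (auto intro: sum_pos2)
    ultimately show "0 < (\<Sum>i<d. \<Sum>j<d. x i * t1 (gap i j) * x j)"
      using psd[of x] \<open>0 < \<eta>\<close> by (simp add: add_nonneg_pos)
  qed
  define K where "K = (\<Sum>n<d. \<bar>t1 n\<bar>)"
  \<comment> \<open>Chosen so that the Fejer loss, at most \<open>d * K / N\<close>, does not exceed
    \<open>\<eta> / 2\<close>.\<close>
  obtain N0 :: nat where N0: "2 * real d * K / \<eta> \<le> real N0" using real_arch_simple by blast
  define N where "N = max d N0"
  have N: "0 < N" "d \<le> N" "2 * real d * K / \<eta> \<le> real N" using N0 assms by (auto simp: N_def)
  obtain t2 where t2: "pos_toep N t2" "\<forall>i<d. t2 i = t1 i"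
    using pos_toep_extension[OF \<open>pos_toep d t1\<close> \<open>0 < d\<close> N(2)] by blast
  \<comment> \<open>Then \<open>D * q\<close> sample points prevent aliasing for every positive
    \<open>D\<close>.\<close>
  define q where "q = N + d"
  have "N + d \<le> D * q" using \<open>0 < D\<close> by (cases D) (auto simp: q_def)
  note fw = fejer_weights[OF t2(1) N(1,2) this]
  define w where "w m = (\<Sum>i<N. \<Sum>j<N. t2 (gap i j) * cos ((real i - real j) * (2 * pi * real m / real (D * q))))
     / (real (D * q) * real N)" for m
  have q: "0 < q" using N by (simp add: q_def)
  have "\<bar>(\<Sum>b<D. \<Sum>r<q. w (b * q + r) * cos (real n * node D q b r)) - t n\<bar> \<le> \<eta>" if n: "n < d" for n
  proof -
    define e where "e = real n * t1 n / real N"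
    have "(\<Sum>b<D. \<Sum>r<q. w (b * q + r) * cos (real n * node D q b r)) = (1 - real n / real N) * t2 n"
      unfolding node_alt[OF q] using sum_nodes[of "\<lambda>m. w m * cos (real n * (2 * pi * real m / real (D * q)))"]
        fw(2)[OF n] by (simp add: w_def)
    also have "\<dots> = t1 n - real n * t1 n / real N" using t2(2) n by (simp add: left_diff_distrib)
    finally have eq: "(\<Sum>b<D. \<Sum>r<q. w (b * q + r) * cos (real n * node D q b r)) = t1 n - e"
      by (simp only: e_def)
    have "\<bar>e\<bar> \<le> real d * K / real N"
      unfolding K_def e_def using n
      by (auto simp: abs_mult intro!: divide_right_mono mult_mono member_le_sum)
    also have "\<dots> \<le> \<eta> / 2" using N(1,3) \<open>0 < \<eta>\<close> by (simp add: field_simps)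
    finally have "\<bar>e\<bar> \<le> \<eta> / 2" .
    moreover have "\<bar>t1 n - t n\<bar> \<le> \<eta> / 2" using \<open>0 < \<eta>\<close> by (simp add: t1_def)
    ultimately show ?thesis unfolding eq by linarith
  qed
  moreover have "0 \<le> w m" for m using fw(1) by (simp add: w_def)
  ultimately show ?thesis using q by (intro exI[of _ q] exI[of _ "\<lambda>b r. w (b * q + r)"]) blast
qed

section \<open>Counting heavy buckets\<close>

definition ip :: "nat \<Rightarrow> (nat \<Rightarrow> real) \<Rightarrow> (nat \<Rightarrow> real) \<Rightarrow> real" where
  "ip d x y = (\<Sum>i<d. x i * y i)"

lemma ip_sym: "ip d x y = ip d y x"
  by (simp add: ip_def mult.commute)

lemma ip_diff_left: "ip d (\<lambda>i. x i - y i) z = ip d x z - ip d y z"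
  and ip_scale_left: "ip d (\<lambda>i. c * x i) z = c * ip d x z"
  and ip_sum_left: "ip d (\<lambda>i. \<Sum>l\<in>L. u l * X l i) z = (\<Sum>l\<in>L. u l * ip d (X l) z)"
  unfolding ip_def
  subgoal by (simp add: left_diff_distrib sum_subtractf)
  subgoal by (simp add: sum_distrib_left mult.assoc)
  subgoal by (simp add: sum_distrib_left sum_distrib_right mult.assoc sum.swap[of _ L])
  done

lemma ip_diff_right: "ip d z (\<lambda>i. x i - y i) = ip d z x - ip d z y"
  and ip_sum_right: "ip d z (\<lambda>i. \<Sum>l\<in>L. u l * X l i) = (\<Sum>l\<in>L. u l * ip d z (X l))"
  unfolding ip_sym[of d z] by (rule ip_diff_left ip_sum_left)+

lemma ip_scale_right: "ip d z (\<lambda>i. c * x i) = c * ip d z x"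
  unfolding ip_sym[of d z] by (rule ip_scale_left)

lemma ip_nonneg: "0 \<le> ip d x x"
  by (simp add: ip_def sum_nonneg)

lemma ip_eq_0D: "ip d x x = 0 \<Longrightarrow> i < d \<Longrightarrow> x i = 0"
  by (simp add: ip_def sum_nonneg_eq_0_iff)

definition orthonormal :: "nat \<Rightarrow> nat \<Rightarrow> (nat \<Rightarrow> nat \<Rightarrow> real) \<Rightarrow> bool" where
  "orthonormal d m Q \<longleftrightarrow> (\<forall>i<m. \<forall>j<m. ip d (Q i) (Q j) = (if i = j then 1 else 0))"

definition oproj :: "nat \<Rightarrow> nat \<Rightarrow> (nat \<Rightarrow> nat \<Rightarrow> real) \<Rightarrow> (nat \<Rightarrow> real) \<Rightarrow> nat \<Rightarrow> real" where
  "oproj d m Q x i = (\<Sum>l<m. ip d (Q l) x * Q l i)"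

lemma ip_oproj_left: "ip d (oproj d m Q x) y = (\<Sum>l<m. ip d (Q l) x * ip d (Q l) y)"
  unfolding oproj_def[abs_def] by (rule ip_sum_left)

lemma ip_oproj:
  assumes "orthonormal d m Q" "i < m"
  shows "ip d (Q i) (oproj d m Q x) = ip d (Q i) x"
proof -
  have "ip d (Q i) (oproj d m Q x) = (\<Sum>l<m. ip d (Q l) x * ip d (Q i) (Q l))"
    unfolding oproj_def[abs_def] by (rule ip_sum_right)
  also have "\<dots> = (\<Sum>l<m. if l = i then ip d (Q i) x else 0)"
    using assms by (intro sum.cong refl) (auto simp: orthonormal_def)
  finally show ?thesis using assms(2) by simp
qed

lemma ip_oproj_self:
  assumes "orthonormal d m Q"
  shows "ip d (oproj d m Q x) (oproj d m Q x) = (\<Sum>l<m. (ip d (Q l) x)\<^sup>2)"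
  unfolding ip_oproj_left using ip_oproj[OF assms] by (simp add: power2_eq_square)

lemma ip_oproj_compl:
  assumes "orthonormal d m Q" "i < m"
  shows "ip d (Q i) (\<lambda>j. x j - oproj d m Q x j) = 0"
  by (simp add: ip_diff_right ip_oproj[OF assms])

lemma ip_oproj_compl_self:
  assumes "orthonormal d m Q"
  shows "ip d (\<lambda>j. x j - oproj d m Q x j) (\<lambda>j. x j - oproj d m Q x j) \<le> ip d x x"
proof -
  have "ip d (oproj d m Q x) (\<lambda>j. x j - oproj d m Q x j) = 0"
    unfolding ip_oproj_left using ip_oproj_compl[OF assms] by simp
  moreover have "ip d x (oproj d m Q x) = (\<Sum>l<m. (ip d (Q l) x)\<^sup>2)"
    unfolding ip_sym[of d x] ip_oproj_left by (simp add: power2_eq_square)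
  ultimately show ?thesis
    by (simp add: ip_diff_left ip_diff_right sum_nonneg)
qed

text \<open>Gram-Schmidt, discarding vectors that depend on earlier ones, hence possibly
  \<open>m < k\<close>. The conclusion speaks of annihilators because the aim is to test membership
  in the kernel of a low-rank matrix.\<close>

lemma gram_schmidt_annihilator:
  "\<exists>Q m. m \<le> k \<and> orthonormal d m Q \<and>
    (\<forall>x. (\<forall>i<m. ip d (Q i) x = 0) \<longrightarrow> (\<forall>i<k. ip d (W i) x = 0))"
proof (induction k)
  case 0
  show ?case by (rule exI, rule exI[of _ 0]) (simp add: orthonormal_def)
next
  case (Suc k)
  then obtain Q m where m: "m \<le> k" and Q: "orthonormal d m Q"
    and ann: "\<And>x. (\<forall>i<m. ip d (Q i) x = 0) \<Longrightarrow> (\<forall>i<k. ip d (W i) x = 0)" by blast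
  define v where "v i = W k i - oproj d m Q (W k) i" for i
  \<comment> \<open>On the annihilator of \<open>Q\<close>, passing from \<open>W k\<close> to its
    residual \<open>v\<close> changes no inner product.\<close>
  have W: "ip d (W k) x = ip d v x" if "\<forall>i<m. ip d (Q i) x = 0" for x
    using that unfolding v_def[abs_def] by (simp add: ip_diff_left ip_oproj_left)
  show ?case
  proof (cases "ip d v v = 0")
    case True
    then have "ip d v x = 0" for x using ip_eq_0D[OF True] by (simp add: ip_def)
    then have "\<forall>i<Suc k. ip d (W i) x = 0" if "\<forall>i<m. ip d (Q i) x = 0" for x
      using W[OF that] ann[OF that] by (simp add: less_Suc_eq)
    then show ?thesis using m Q by (intro exI[of _ Q] exI[of _ m]) auto
  next
    case False
    define s where "s = sqrt (ip d v v)"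
    have s: "s \<noteq> 0" "s * s = ip d v v" using False ip_nonneg[of d v] by (simp_all add: s_def)
    define Q' where "Q' = Q(m := (\<lambda>i. inverse s * v i))"
    have Qv: "ip d (Q i) v = 0" if "i < m" for i
      unfolding v_def[abs_def] using ip_oproj_compl[OF Q that] by simp
    have "ip d (Q' m) (Q' m) = inverse s * (inverse s * (s * s))"
      by (simp add: Q'_def ip_scale_left ip_scale_right s(2))
    also have "\<dots> = 1" using s(1) by (simp add: field_simps)
    finally have "ip d (Q' m) (Q' m) = 1" .
    moreover have "ip d (Q' m) (Q' i) = 0" "ip d (Q' i) (Q' m) = 0" if "i < m" for i
      using Qv[OF that] that ip_sym[of d v "Q i"] by (simp_all add: Q'_def ip_scale_left ip_scale_right)
    moreover have "ip d (Q' i) (Q' j) = (if i = j then 1 else 0)" if "i < m" "j < m" for i j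
      using Q that by (simp add: Q'_def orthonormal_def)
    ultimately have "orthonormal d (Suc m) Q'"
      unfolding orthonormal_def by (auto simp: less_Suc_eq)
    moreover have "\<forall>i<Suc k. ip d (W i) x = 0" if x: "\<forall>i<Suc m. ip d (Q' i) x = 0" for x
    proof -
      have 1: "\<forall>i<m. ip d (Q i) x = 0" using x by (auto simp: Q'_def less_Suc_eq)
      have "ip d (Q' m) x = 0" using x by simp
      then have "ip d v x = 0" using s by (simp add: Q'_def ip_scale_left)
      then show ?thesis using W[OF 1] ann[OF 1] by (simp add: less_Suc_eq)
    qed
    ultimately show ?thesis using m by (intro exI[of _ Q'] exI[of _ "Suc m"]) auto
  qed
qed

text \<open>The trace argument: test vectors are the cosine and sine vectors at the left endpoints of
  the heavy buckets. Only \<open>m\<close> dimensions are lost by projecting them away from \<open>Q\<close>.\<close>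

lemma heavy_buckets_card:
  assumes d: "0 < d" and q: "0 < q" and w: "\<And>b r. 0 \<le> w b r" and \<sigma>: "0 < \<sigma>"
    and Q: "orthonormal d m Q"
    and small: "\<And>x. (\<forall>i<m. ip d (Q i) x = 0) \<Longrightarrow>
      (\<Sum>b<16 * d. \<Sum>r<q. w b r * (cmod (tpoly d x (node (16 * d) q b r)))\<^sup>2) \<le> \<sigma> * ip d x x"
  shows "card {b. b < 16 * d \<and> 32 * \<sigma> / real d < (\<Sum>r<q. w b r)} \<le> 73728 * m"
proof -
  define D where "D = 16 * d"
  define \<tau> where "\<tau> = 32 * \<sigma> / real d"
  define W where "W b = (\<Sum>r<q. w b r)" for b
  define H where "H = {b. b < D \<and> \<tau> < W b}"
  \<comment> \<open>Heavy buckets are scaled down to mass exactly \<open>\<tau>\<close> and the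
    others dropped: the large sieve then applies with \<open>\<tau>\<close>, while
    \<open>v \<le> w\<close> keeps the bound \<open>small\<close> available.\<close>
  define v where "v b r = (if b \<in> H then \<tau> / W b * w b r else 0)" for b r
  define F where "F x = (\<Sum>b<D. \<Sum>r<q. v b r * (cmod (tpoly d x (node D q b r)))\<^sup>2)" for x
  define c s where "c b j = cos (real j * (2 * pi * real b / real D))"
    and "s b j = sin (real j * (2 * pi * real b / real D))" for b j
  define P where "P x j = x j - oproj d m Q x j" for x j
  have D: "0 < D" using d by (simp add: D_def)
  have \<tau>: "0 < \<tau>" using \<sigma> d by (simp add: \<tau>_def)
  have HD: "H \<subseteq> {..<D}" "finite H" by (auto simp: H_def)
  have W: "0 < W b" "\<tau> < W b" if "b \<in> H" for b using that \<tau> by (auto simp: H_def)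
  have v0: "0 \<le> v b r" for b r
  proof (cases "b \<in> H")
    case True
    then show ?thesis
      using W(1)[OF True] \<tau> w[of b r] by (simp add: v_def zero_le_mult_iff zero_le_divide_iff)
  qed (simp add: v_def)
  have vw: "v b r \<le> w b r" for b r
  proof (cases "b \<in> H")
    case True
    then have "\<tau> / W b * w b r \<le> 1 * w b r"
      using W[OF True] w[of b r] by (intro mult_right_mono) auto
    then show ?thesis using True by (simp add: v_def)
  qed (simp add: v_def w)
  have mass: "(\<Sum>r<q. v b r) = (if b \<in> H then \<tau> else 0)" for b
  proof (cases "b \<in> H")
    case True
    then have "(\<Sum>r<q. v b r) = \<tau> / W b * W b" by (simp add: v_def W_def sum_distrib_left)
    then show ?thesis using W(1)[OF True] True by simp
  qed (simp add: v_def)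
  have F0: "0 \<le> F x" for x unfolding F_def by (intro sum_nonneg mult_nonneg_nonneg v0) auto
  have Fup: "F x \<le> 9 * real D * \<tau> * ip d x x" for x
    unfolding F_def ip_def power2_eq_square[of "x _", symmetric]
    by (rule large_sieve) (use q D v0 \<tau> in \<open>auto simp: D_def mass\<close>)
  have FP: "F (P x) \<le> \<sigma> * ip d x x" for x
  proof -
    have "F (P x) \<le> (\<Sum>b<D. \<Sum>r<q. w b r * (cmod (tpoly d (P x) (node D q b r)))\<^sup>2)"
      unfolding F_def by (intro sum_mono mult_right_mono vw) auto
    also have "\<dots> \<le> \<sigma> * ip d (P x) (P x)"
      unfolding D_def by (rule small) (simp add: P_def[abs_def] ip_oproj_compl[OF Q])
    also have "\<dots> \<le> \<sigma> * ip d x x"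
      unfolding P_def[abs_def] using \<sigma> by (intro mult_left_mono ip_oproj_compl_self[OF Q]) auto
    finally show ?thesis .
  qed
  have Fsplit: "F x \<le> 2 * F (P x) + 2 * F (oproj d m Q x)" for x
  proof -
    have "(cmod (tpoly d x \<theta>))\<^sup>2 \<le> 2 * (cmod (tpoly d (P x) \<theta>))\<^sup>2 + 2 * (cmod (tpoly d (oproj d m Q x) \<theta>))\<^sup>2" for \<theta>
    proof -
      have "tpoly d x \<theta> = tpoly d (P x) \<theta> + tpoly d (oproj d m Q x) \<theta>"
        unfolding tpoly_add[symmetric] by (simp add: P_def)
      then have "(cmod (tpoly d x \<theta>))\<^sup>2 \<le> (cmod (tpoly d (P x) \<theta>) + cmod (tpoly d (oproj d m Q x) \<theta>))\<^sup>2"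
        by (simp add: norm_triangle_ineq power_mono)
      also have "\<dots> \<le> 2 * (cmod (tpoly d (P x) \<theta>))\<^sup>2 + 2 * (cmod (tpoly d (oproj d m Q x) \<theta>))\<^sup>2"
        using sum_squares_bound[of "cmod (tpoly d (P x) \<theta>)" "cmod (tpoly d (oproj d m Q x) \<theta>)"]
        by (simp add: power2_sum)
      finally show ?thesis .
    qed
    then have "F x \<le> (\<Sum>b<D. \<Sum>r<q. v b r * (2 * (cmod (tpoly d (P x) (node D q b r)))\<^sup>2
        + 2 * (cmod (tpoly d (oproj d m Q x) (node D q b r)))\<^sup>2))"
      unfolding F_def by (intro sum_mono mult_left_mono v0)
    also have "\<dots> = 2 * F (P x) + 2 * F (oproj d m Q x)"
      by (simp add: F_def sum_distrib_left sum.distrib distrib_left mult.left_commute)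
    finally show ?thesis .
  qed
  have lower: "\<tau> * (real d)\<^sup>2 / 8 \<le> F (c b) + F (s b)" if b: "b \<in> H" for b
  proof -
    \<comment> \<open>At each node of the bucket the two test vectors combine to the sum of
      \<open>cos (j * g)\<close> over \<open>j < d\<close>; every phase \<open>j * g\<close> is at
      most \<open>pi / 3\<close>, so the sum is at least \<open>d / 2\<close>. Squaring a sum of two
      moduli costs a factor 2, whence \<open>d\<^sup>2 / 8\<close>.\<close>
    have pt: "(real d)\<^sup>2 / 8 \<le> (cmod (tpoly d (c b) (node D q b r)))\<^sup>2 + (cmod (tpoly d (s b) (node D q b r)))\<^sup>2"
      if r: "r < q" for r
    proof -
      define \<theta> where "\<theta> = node D q b r"
      define g where "g = 2 * pi * real r / (real q * real D)"
      have "real d / 2 \<le> Re (tpoly d (c b) \<theta> - \<i> * tpoly d (s b) \<theta>)"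
      proof -
        have "Re (tpoly d (c b) \<theta> - \<i> * tpoly d (s b) \<theta>) = (\<Sum>j<d. cos (real j * g))"
        proof -
          have "c b j * cos (real j * \<theta>) + s b j * sin (real j * \<theta>) = cos (real j * g)" for j
          proof -
            have "real j * \<theta> = real j * (2 * pi * real b / real D) + real j * g"
              by (simp add: \<theta>_def node_def g_def distrib_left)
            then have "cos (real j * g) = cos (real j * \<theta> - real j * (2 * pi * real b / real D))" by simp
            then show ?thesis by (simp add: cos_diff c_def s_def)
          qed
          then show ?thesis by (simp add: tpoly_Re tpoly_Im sum.distrib[symmetric])
        qed
        moreover have "1 / 2 \<le> cos (real j * g)" if j: "j < d" for j
        proof -
          have "real j * g \<le> pi / 3"
          proof -
            have "real j * real r \<le> real d * real q" using j r by (intro mult_mono) auto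
            moreover have "0 \<le> real d * real q" by simp
            ultimately have "6 * (real j * real r) \<le> 16 * (real d * real q)" by linarith
            then have "pi * (6 * (real j * real r)) \<le> pi * (16 * (real d * real q))"
              using pi_gt_zero by (intro mult_left_mono) auto
            then show ?thesis using q d by (simp add: g_def D_def divide_simps mult_ac)
          qed
          moreover have "0 \<le> real j * g" by (simp add: g_def)
          ultimately have "cos (pi / 3) \<le> cos (real j * g)"
            using pi_gt_zero by (intro cos_monotone_0_pi_le) auto
          then show ?thesis by (simp add: cos_60)
        qed
        then have "(\<Sum>j<d. 1 / 2) \<le> (\<Sum>j<d. cos (real j * g))" by (intro sum_mono) auto
        ultimately show ?thesis by simp
      qed
      also have "\<dots> \<le> cmod (tpoly d (c b) \<theta> - \<i> * tpoly d (s b) \<theta>)" by (rule complex_Re_le_cmod)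
      also have "\<dots> \<le> cmod (tpoly d (c b) \<theta>) + cmod (tpoly d (s b) \<theta>)"
        using norm_triangle_ineq4[of "tpoly d (c b) \<theta>" "\<i> * tpoly d (s b) \<theta>"] by (simp add: norm_mult)
      finally have "(real d / 2)\<^sup>2 \<le> (cmod (tpoly d (c b) \<theta>) + cmod (tpoly d (s b) \<theta>))\<^sup>2"
        by (intro power_mono) auto
      also have "\<dots> \<le> 2 * ((cmod (tpoly d (c b) \<theta>))\<^sup>2 + (cmod (tpoly d (s b) \<theta>))\<^sup>2)"
        using sum_squares_bound[of "cmod (tpoly d (c b) \<theta>)" "cmod (tpoly d (s b) \<theta>)"]
        by (simp add: power2_sum)
      finally show ?thesis by (simp add: \<theta>_def power_divide)
    qed
    have "\<tau> * (real d)\<^sup>2 / 8 = (\<Sum>r<q. v b r * ((real d)\<^sup>2 / 8))"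
      using mass[of b] b by (simp only: sum_distrib_right[symmetric]) simp
    also have "\<dots> \<le> (\<Sum>r<q. v b r * ((cmod (tpoly d (c b) (node D q b r)))\<^sup>2 + (cmod (tpoly d (s b) (node D q b r)))\<^sup>2))"
      by (intro sum_mono mult_left_mono v0 pt) auto
    also have "\<dots> \<le> (\<Sum>b'<D. \<Sum>r<q. v b' r * ((cmod (tpoly d (c b) (node D q b' r)))\<^sup>2 + (cmod (tpoly d (s b) (node D q b' r)))\<^sup>2))"
      using HD b by (intro member_le_sum[of b] sum_nonneg mult_nonneg_nonneg v0 add_nonneg_nonneg) auto
    also have "\<dots> = F (c b) + F (s b)"
      by (simp add: F_def distrib_left sum.distrib)
    finally show ?thesis .
  qed
  have cs: "ip d (c b) (c b) + ip d (s b) (s b) = real d" for b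
    by (simp add: ip_def c_def s_def sum.distrib[symmetric] power2_eq_square[symmetric])
  define E where "E b = ip d (oproj d m Q (c b)) (oproj d m Q (c b)) + ip d (oproj d m Q (s b)) (oproj d m Q (s b))" for b
  \<comment> \<open>The projection energies are samples of the polynomials of \<open>Q\<close> at
    bucket endpoints; enlarging \<open>H\<close> to all endpoints lets Parseval evaluate them, with
    \<open>D\<close> per unit vector.\<close>
  have projected: "(\<Sum>b\<in>H. E b)
     \<le> real m * real D"
  proof -
    have "(\<Sum>b\<in>H. E b)
       = (\<Sum>b\<in>H. \<Sum>l<m. (cmod (tpoly d (Q l) (2 * pi * real b / real D)))\<^sup>2)"
      unfolding E_def ip_oproj_self[OF Q] sum.distrib[symmetric] cmod_power2 tpoly_Re tpoly_Im
      by (simp add: ip_def c_def s_def)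
    also have "\<dots> = (\<Sum>l<m. \<Sum>b\<in>H. (cmod (tpoly d (Q l) (2 * pi * real b / real D)))\<^sup>2)"
      by (rule sum.swap)
    also have "\<dots> \<le> (\<Sum>l<m. \<Sum>b<D. (cmod (tpoly d (Q l) (2 * pi * real b / real D)))\<^sup>2)"
      using HD by (intro sum_mono sum_mono2) auto
    also have "\<dots> = (\<Sum>l<m. real D * ip d (Q l) (Q l))"
      by (subst tpoly_parseval) (simp_all add: D_def ip_def power2_eq_square)
    also have "\<dots> = real m * real D" using Q by (simp add: orthonormal_def)
    finally show ?thesis .
  qed
  have "real (card H) * (\<tau> * (real d)\<^sup>2 / 8) = (\<Sum>b\<in>H. \<tau> * (real d)\<^sup>2 / 8)" by simp
  also have "\<dots> \<le> (\<Sum>b\<in>H. F (c b) + F (s b))" by (intro sum_mono lower)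
  \<comment> \<open>Each test vector is split into its part off \<open>Q\<close>, where
    \<open>small\<close> applies, and its part in the span of \<open>Q\<close>, where the large
    sieve applies.\<close>
  also have "\<dots> \<le> (\<Sum>b\<in>H. 2 * \<sigma> * real d + 18 * real D * \<tau> *
      E b)"
  proof (rule sum_mono)
    fix b
    have "F (c b) + F (s b) \<le> 2 * (\<sigma> * ip d (c b) (c b)) + 2 * (\<sigma> * ip d (s b) (s b))
        + 2 * (9 * real D * \<tau> * ip d (oproj d m Q (c b)) (oproj d m Q (c b)))
        + 2 * (9 * real D * \<tau> * ip d (oproj d m Q (s b)) (oproj d m Q (s b)))"
      using Fsplit[of "c b"] Fsplit[of "s b"] FP[of "c b"] FP[of "s b"]
        Fup[of "oproj d m Q (c b)"] Fup[of "oproj d m Q (s b)"] by linarith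
    also have "2 * (\<sigma> * ip d (c b) (c b)) + 2 * (\<sigma> * ip d (s b) (s b)) = 2 * \<sigma> * real d"
      unfolding cs[of b, symmetric] by (simp add: algebra_simps)
    finally show "F (c b) + F (s b) \<le> 2 * \<sigma> * real d + 18 * real D * \<tau> *
      E b"
      by (simp add: E_def algebra_simps)
  qed
  also have "\<dots> \<le> real (card H) * (2 * \<sigma> * real d) + 18 * real D * \<tau> * (real m * real D)"
    unfolding sum.distrib sum_distrib_left[symmetric]
    using \<tau> by (intro add_mono mult_left_mono projected) auto
  finally have total: "real (card H) * (\<tau> * (real d)\<^sup>2 / 8)
      \<le> real (card H) * (2 * \<sigma> * real d) + 18 * real D * \<tau> * (real m * real D)" .
  \<comment> \<open>The 32 in \<open>\<tau>\<close> gives each heavy bucket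
    \<open>4 * (\<sigma> * d)\<close> on the left against \<open>2 * (\<sigma> * d)\<close> on the
    right, so half of the left side survives. The constant 147456 is 18 * 16 * 32 * 16.\<close>
  have scale: "\<tau> * (real d)\<^sup>2 / 8 = 4 * (\<sigma> * real d)"
    "18 * real D * \<tau> * (real m * real D) = 147456 * (\<sigma> * real d) * real m"
    using d by (simp_all add: \<tau>_def D_def power2_eq_square)
  have "(\<sigma> * real d) * (2 * real (card H)) \<le> (\<sigma> * real d) * (147456 * real m)"
    using total unfolding scale by (simp add: algebra_simps)
  moreover have "0 < \<sigma> * real d" using \<sigma> d by simp
  ultimately have "2 * real (card H) \<le> 147456 * real m"
    by (rule mult_left_le_imp_le)
  then have "real (card H) \<le> real (73728 * m)" by simp
  then have "card H \<le> 73728 * m" by (simp only: of_nat_le_iff)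
  then show ?thesis unfolding H_def \<tau>_def W_def D_def .
qed

section \<open>Rank and operator norm\<close>

lemma rank_le_1_entries:
  fixes f g :: "nat \<Rightarrow> real"
  shows "vec_space.rank d (mat d d (\<lambda>(i, j). f i * g j)) \<le> 1"
  by (rule vec_space.rank_le_1_product_entries[where f = f and g = g]) auto

text \<open>Each term contributes two products of real vectors, since
  \<open>Re (z * w) = Re z * Re w - Im z * Im w\<close>.\<close>

lemma rank_sum_Re_products:
  fixes f g :: "'l \<Rightarrow> nat \<Rightarrow> complex"
  assumes "finite I"
  shows "vec_space.rank d (mat d d (\<lambda>(i, j). Re (\<Sum>l\<in>I. f l i * g l j))) \<le> 2 * card I"
  using assms
proof (induction I)
  case empty
  have "mat d d (\<lambda>(i, j). Re (\<Sum>l\<in>{}. f l i * g l j)) = (0\<^sub>m d d :: real mat)" by (intro eq_matI) auto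
  then show ?case by (simp only: vec_space.rank_0I)
next
  case (insert l I)
  let ?A = "mat d d (\<lambda>(i, j). Re (\<Sum>l\<in>I. f l i * g l j))"
  let ?R = "mat d d (\<lambda>(i, j). Re (f l i) * Re (g l j))"
  let ?S = "mat d d (\<lambda>(i, j). (- Im (f l i)) * Im (g l j))"
  have "mat d d (\<lambda>(i, j). Re (\<Sum>l\<in>insert l I. f l i * g l j)) = ?A + (?R + ?S)"
    using insert.hyps by (intro eq_matI) auto
  moreover have "vec_space.rank d (?A + (?R + ?S)) \<le> vec_space.rank d ?A + vec_space.rank d (?R + ?S)"
    by (rule vec_space.rank_subadditive) auto
  moreover have "vec_space.rank d (?R + ?S) \<le> vec_space.rank d ?R + vec_space.rank d ?S"
    by (rule vec_space.rank_subadditive) auto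
  moreover have "vec_space.rank d ?R \<le> 1" "vec_space.rank d ?S \<le> 1"
    by (rule rank_le_1_entries)+
  ultimately show ?case using insert by simp
qed

text \<open>A maximal independent set of columns has at most \<open>k\<close> members and spans all
  columns. With \<open>W l\<close> listing the coefficients of its \<open>l\<close>-th member in
  each column, \<open>B x\<close> is the combination of these members with coefficients
  \<open>ip d (W l) x\<close>.\<close>

lemma rank_annihilator:
  fixes B :: "real mat"
  assumes B: "B \<in> carrier_mat d d" and rk: "vec_space.rank d B \<le> k"
  shows "\<exists>W. \<forall>x. (\<forall>i<k. ip d (W i) x = 0) \<longrightarrow> (\<forall>i<d. (\<Sum>j<d. B $$ (i, j) * x j) = 0)"
proof -
  interpret vec_space "TYPE(real)" d .
  have cB: "set (cols B) \<subseteq> carrier_vec d" using B cols_dim by blast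
  obtain S where S: "maximal S (\<lambda>T. T \<subseteq> set (cols B) \<and> lin_indpt T)"
    using maximal_exists_superset[of "set (cols B)" "\<lambda>T. T \<subseteq> set (cols B) \<and> lin_indpt T" "{}"]
    by (auto simp: lin_dep_def)
  then have SB: "S \<subseteq> set (cols B)" "lin_indpt S" by (auto simp: maximal_def)
  then have finS: "finite S" using infinite_super by blast
  have S_dim: "S \<subseteq> carrier_vec d" using SB cB by blast
  have "card S \<le> k" using rank_card_indpt[OF B S] rk by simp
  have in_span: "v \<in> span S" if v: "v \<in> set (cols B)" for v
  proof (rule ccontr)
    assume nv: "v \<notin> span S"
    have "v \<in> carrier_vec d" using v cB by blast
    have "lin_indpt (S \<union> {v})"
      using lin_dep_iff_in_span[OF S_dim SB(2) \<open>v \<in> carrier_vec d\<close>] nv span_mem[OF S_dim] by auto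
    then have "S = S \<union> {v}" using S SB v unfolding maximal_def by blast
    then show False using nv span_mem[OF S_dim] by auto
  qed
  have "\<forall>j<d. \<exists>a. col B j = lincomb a S"
    using in_span B finite_in_span[OF finS S_dim] by (metis carrier_matD(2) cols_length cols_nth nth_mem)
  then obtain a where a: "\<And>j. j < d \<Longrightarrow> col B j = lincomb (a j) S" by metis
  obtain e where e: "bij_betw e {..<card S} S"
    using ex_bij_betw_nat_finite[OF finS] by (auto simp: lessThan_atLeast0)
  have entry: "B $$ (i, j) = (\<Sum>l<card S. a j (e l) * e l $ i)" if "i < d" "j < d" for i j
  proof -
    have "B $$ (i, j) = col B j $ i" using B that by simp
    also have "\<dots> = (\<Sum>v\<in>S. a j v * v $ i)" using a[OF that(2)] that S_dim by (simp add: lincomb_index)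
    also have "\<dots> = (\<Sum>l<card S. a j (e l) * e l $ i)"
      by (rule sum.reindex_bij_betw[OF e, symmetric])
    finally show ?thesis .
  qed
  have "(\<Sum>j<d. B $$ (i, j) * x j) = 0" if x: "\<forall>l<k. ip d (\<lambda>j. a j (e l)) x = 0" and i: "i < d" for x i
  proof -
    have "(\<Sum>j<d. B $$ (i, j) * x j) = (\<Sum>j<d. \<Sum>l<card S. e l $ i * (a j (e l) * x j))"
      using i by (intro sum.cong refl) (simp add: entry sum_distrib_left mult_ac)
    also have "\<dots> = (\<Sum>l<card S. e l $ i * ip d (\<lambda>j. a j (e l)) x)"
      by (subst sum.swap) (simp add: ip_def sum_distrib_left)
    also have "\<dots> = 0" using x \<open>card S \<le> k\<close> by simp
    finally show ?thesis .
  qed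
  \<comment> \<open>Indices \<open>l\<close> from \<open>card S\<close> on give arbitrary vectors;
    they only add conditions on \<open>x\<close>.\<close>
  then show ?thesis by (intro exI[of _ "\<lambda>l j. a j (e l)"]) blast
qed

section \<open>Operator norm bounds through bilinear forms\<close>

text \<open>An operator norm bound in weak form: it adds up easily and applies to entry functions
  directly, before any matrix is built.\<close>

definition op_le :: "nat \<Rightarrow> (nat \<Rightarrow> nat \<Rightarrow> real) \<Rightarrow> real \<Rightarrow> bool" where
  "op_le d A c \<longleftrightarrow> (\<forall>x y. \<bar>\<Sum>i<d. \<Sum>j<d. y i * A i j * x j\<bar> \<le> c * (L2_set y {..<d} * L2_set x {..<d}))"

lemma op_le_add:
  assumes "op_le d A a" "op_le d B b"
  shows "op_le d (\<lambda>i j. A i j + B i j) (a + b)"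
  unfolding op_le_def
proof (intro allI)
  fix x y
  have "(\<Sum>i<d. \<Sum>j<d. y i * (A i j + B i j) * x j)
    = (\<Sum>i<d. \<Sum>j<d. y i * A i j * x j) + (\<Sum>i<d. \<Sum>j<d. y i * B i j * x j)"
    by (simp add: distrib_left distrib_right sum.distrib)
  then show "\<bar>\<Sum>i<d. \<Sum>j<d. y i * (A i j + B i j) * x j\<bar> \<le> (a + b) * (L2_set y {..<d} * L2_set x {..<d})"
    using assms[unfolded op_le_def, rule_format, of y x] unfolding distrib_right by linarith
qed

text \<open>In each argument the l1 norm is at most \<open>sqrt d\<close> times the l2 norm.\<close>

lemma op_le_entrywise:
  assumes "\<And>i j. i < d \<Longrightarrow> j < d \<Longrightarrow> \<bar>A i j\<bar> \<le> \<epsilon>" "0 \<le> \<epsilon>"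
  shows "op_le d A (real d * \<epsilon>)"
  unfolding op_le_def
proof (intro allI)
  fix x y :: "nat \<Rightarrow> real"
  have l1: "(\<Sum>i<d. \<bar>z i\<bar>) \<le> sqrt (real d) * L2_set z {..<d}" for z :: "nat \<Rightarrow> real"
    using L2_set_mult_ineq[of "\<lambda>_. 1" z "{..<d}"] by (simp add: L2_set_def)
  have "\<bar>\<Sum>i<d. \<Sum>j<d. y i * A i j * x j\<bar> \<le> (\<Sum>i<d. \<Sum>j<d. \<bar>y i\<bar> * \<epsilon> * \<bar>x j\<bar>)"
    by (intro order_trans[OF sum_abs] sum_mono)
       (auto simp: abs_mult assms(2) intro!: order_trans[OF sum_abs] sum_mono mult_mono assms(1))
  also have "\<dots> = \<epsilon> * ((\<Sum>i<d. \<bar>y i\<bar>) * (\<Sum>j<d. \<bar>x j\<bar>))"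
    by (simp add: sum_product sum_distrib_left mult_ac)
  also have "\<dots> \<le> \<epsilon> * ((sqrt (real d) * L2_set y {..<d}) * (sqrt (real d) * L2_set x {..<d}))"
    using assms(2) by (intro mult_left_mono mult_mono l1) (auto intro: sum_nonneg)
  also have "\<dots> = real d * \<epsilon> * (L2_set y {..<d} * L2_set x {..<d})"
    by (simp add: algebra_simps)
  finally show "\<bar>\<Sum>i<d. \<Sum>j<d. y i * A i j * x j\<bar> \<le> real d * \<epsilon> * (L2_set y {..<d} * L2_set x {..<d})" .
qed

lemma vec_norm2_L2: "vec_norm2 v = L2_set (\<lambda>i. v $ i) {..<dim_vec v}"
  by (simp add: vec_norm2_def L2_set_def scalar_prod_def lessThan_atLeast0 power2_eq_square)

lemma mult_mat_vec_entry:
  "A \<in> carrier_mat d d \<Longrightarrow> v \<in> carrier_vec d \<Longrightarrow> i < d \<Longrightarrow> (A *\<^sub>v v) $ i = (\<Sum>j<d. A $$ (i, j) * v $ j)"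
  by (auto simp: scalar_prod_def lessThan_atLeast0 intro!: sum.cong)

text \<open>Testing the form with \<open>A v\<close> itself bounds the squared norm of
  \<open>A v\<close> by \<open>c\<close> times the product of the norms of \<open>A v\<close> and
  \<open>v\<close>, and one factor cancels.\<close>

lemma op_le_vec_norm2:
  assumes A: "A \<in> carrier_mat d d" and c: "op_le d (\<lambda>i j. A $$ (i, j)) c" and v: "v \<in> carrier_vec d" "0 \<le> c"
  shows "vec_norm2 (A *\<^sub>v v) \<le> c * vec_norm2 v"
proof -
  define y where "y = L2_set (\<lambda>i. (A *\<^sub>v v) $ i) {..<d}"
  define x where "x = L2_set (\<lambda>i. v $ i) {..<d}"
  have y2: "y * y = (\<Sum>i<d. (A *\<^sub>v v) $ i * (A *\<^sub>v v) $ i)"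
    by (simp add: y_def L2_set_def sum_nonneg power2_eq_square)
  also have "\<dots> = (\<Sum>i<d. \<Sum>j<d. (A *\<^sub>v v) $ i * A $$ (i, j) * v $ j)"
    by (intro sum.cong refl, subst (2) mult_mat_vec_entry[OF A v(1)]) (auto simp: sum_distrib_left mult.assoc)
  also have "\<dots> \<le> c * (y * x)"
    using c[unfolded op_le_def, rule_format, of "\<lambda>i. (A *\<^sub>v v) $ i" "\<lambda>i. v $ i"]
    unfolding y_def x_def by linarith
  finally have "y * y \<le> y * (c * x)" by (simp add: algebra_simps)
  then have "y \<le> c * x"
    using v(2) L2_set_nonneg by (cases "y = 0") (auto simp: y_def x_def order_less_le)
  then show ?thesis using A v by (simp add: vec_norm2_L2 y_def x_def)
qed

lemma vec_norm2_nonneg: "0 \<le> vec_norm2 v"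
  by (simp add: vec_norm2_L2 L2_set_nonneg)

lemma spectral_norm_le:
  assumes A: "A \<in> carrier_mat d d" and c: "op_le d (\<lambda>i j. A $$ (i, j)) c" "0 \<le> c"
  shows "spectral_norm A \<le> c"
  unfolding spectral_norm_def
proof (rule cSUP_least)
  have "0\<^sub>v d \<in> {x \<in> carrier_vec (dim_col A). vec_norm2 x \<le> 1}"
    using A by (simp add: vec_norm2_L2 L2_set_def)
  then show "{x \<in> carrier_vec (dim_col A). vec_norm2 x \<le> 1} \<noteq> {}" by blast
next
  fix x assume "x \<in> {x \<in> carrier_vec (dim_col A). vec_norm2 x \<le> 1}"
  then have x: "x \<in> carrier_vec d" "vec_norm2 x \<le> 1" using A by auto
  have "vec_norm2 (A *\<^sub>v x) \<le> c * vec_norm2 x" by (rule op_le_vec_norm2[OF A c(1) x(1) c(2)])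
  also have "\<dots> \<le> c * 1" using x c by (intro mult_left_mono) auto
  finally show "vec_norm2 (A *\<^sub>v x) \<le> c" by simp
qed

text \<open>A crude bound which shows that the supremum in \<open>spectral_norm\<close> is over a
  bounded set, and which handles vectors of norm 0.\<close>

lemma op_le_sum_abs:
  "op_le d A (real d * (\<Sum>i<d. \<Sum>j<d. \<bar>A i j\<bar>))"
proof (rule op_le_entrywise)
  fix i j assume ij: "i < d" "j < d"
  have "\<bar>A i j\<bar> \<le> (\<Sum>j<d. \<bar>A i j\<bar>)"
    using ij by (intro member_le_sum[of j "{..<d}" "\<lambda>j. \<bar>A i j\<bar>"]) auto
  also have "\<dots> \<le> (\<Sum>i<d. \<Sum>j<d. \<bar>A i j\<bar>)"
    using ij by (intro member_le_sum[of i "{..<d}" "\<lambda>i. \<Sum>j<d. \<bar>A i j\<bar>"]) (auto intro: sum_nonneg)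
  finally show "\<bar>A i j\<bar> \<le> (\<Sum>i<d. \<Sum>j<d. \<bar>A i j\<bar>)" .
qed (intro sum_nonneg, auto)

lemma spectral_norm_upper:
  assumes A: "A \<in> carrier_mat d d" and v: "v \<in> carrier_vec d" "vec_norm2 v \<le> 1"
  shows "vec_norm2 (A *\<^sub>v v) \<le> spectral_norm A"
  unfolding spectral_norm_def
proof (rule cSUP_upper)
  let ?c = "real d * (\<Sum>i<d. \<Sum>j<d. \<bar>A $$ (i, j)\<bar>)"
  have c: "0 \<le> ?c" by (intro mult_nonneg_nonneg sum_nonneg) auto
  show "bdd_above ((\<lambda>x. vec_norm2 (A *\<^sub>v x)) ` {x \<in> carrier_vec (dim_col A). vec_norm2 x \<le> 1})"
  proof (intro bdd_aboveI2)
    fix x assume "x \<in> {x \<in> carrier_vec (dim_col A). vec_norm2 x \<le> 1}"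
    then have x: "x \<in> carrier_vec d" "vec_norm2 x \<le> 1" using A by auto
    have "vec_norm2 (A *\<^sub>v x) \<le> ?c * vec_norm2 x"
      by (rule op_le_vec_norm2[OF A op_le_sum_abs x(1) c])
    also have "\<dots> \<le> ?c * 1" using x c by (intro mult_left_mono) auto
    finally show "vec_norm2 (A *\<^sub>v x) \<le> ?c" by simp
  qed
qed (use A v in auto)

lemma spectral_norm_nonneg:
  assumes A: "A \<in> carrier_mat d d"
  shows "0 \<le> spectral_norm A"
proof -
  have "vec_norm2 (A *\<^sub>v 0\<^sub>v d) \<le> spectral_norm A"
    by (rule spectral_norm_upper[OF A]) (simp_all add: vec_norm2_L2 L2_set_def)
  then show ?thesis using vec_norm2_nonneg order_trans by blast
qed

lemma vec_norm2_le_spectral_norm: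
  assumes A: "A \<in> carrier_mat d d" and v: "v \<in> carrier_vec d"
  shows "vec_norm2 (A *\<^sub>v v) \<le> spectral_norm A * vec_norm2 v"
proof (cases "vec_norm2 v = 0")
  case True
  have "vec_norm2 (A *\<^sub>v v) \<le> real d * (\<Sum>i<d. \<Sum>j<d. \<bar>A $$ (i, j)\<bar>) * vec_norm2 v"
    by (rule op_le_vec_norm2[OF A op_le_sum_abs v]) (intro mult_nonneg_nonneg sum_nonneg, auto)
  then show ?thesis using True by simp
next
  case False
  define n where "n = vec_norm2 v"
  have n: "0 < n" using False vec_norm2_nonneg[of v] by (simp add: n_def)
  have scale: "vec_norm2 (c \<cdot>\<^sub>v u) = \<bar>c\<bar> * vec_norm2 u" for c u
    by (simp add: vec_norm2_L2 L2_set_def power_mult_distrib sum_distrib_left[symmetric] real_sqrt_mult)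
  have "vec_norm2 (A *\<^sub>v ((1 / n) \<cdot>\<^sub>v v)) \<le> spectral_norm A"
    by (rule spectral_norm_upper[OF A]) (use v n in \<open>auto simp: scale n_def\<close>)
  moreover have "A *\<^sub>v ((1 / n) \<cdot>\<^sub>v v) = (1 / n) \<cdot>\<^sub>v (A *\<^sub>v v)"
    using A v by (rule mult_mat_vec)
  ultimately show ?thesis using n by (simp add: scale n_def field_simps)
qed

lemma quadratic_form_le_spectral_norm:
  assumes A: "A \<in> carrier_mat d d"
  shows "(\<Sum>i<d. x i * (\<Sum>j<d. A $$ (i, j) * x j)) \<le> spectral_norm A * ip d x x"
proof -
  define v where "v = vec d x"
  have v: "v \<in> carrier_vec d" by (simp add: v_def)
  have L: "vec_norm2 v = L2_set x {..<d}" by (auto simp: vec_norm2_L2 v_def intro!: L2_set_cong)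
  have "(\<Sum>i<d. x i * (\<Sum>j<d. A $$ (i, j) * x j)) = (\<Sum>i<d. x i * (A *\<^sub>v v) $ i)"
    using mult_mat_vec_entry[OF A v] by (simp add: v_def)
  also have "\<dots> \<le> (\<Sum>i<d. \<bar>x i\<bar> * \<bar>(A *\<^sub>v v) $ i\<bar>)"
    by (intro sum_mono) (simp add: abs_mult[symmetric])
  also have "\<dots> \<le> L2_set x {..<d} * L2_set (\<lambda>i. (A *\<^sub>v v) $ i) {..<d}"
    by (rule L2_set_mult_ineq)
  also have "\<dots> = L2_set x {..<d} * vec_norm2 (A *\<^sub>v v)" using A by (simp add: vec_norm2_L2)
  also have "\<dots> \<le> L2_set x {..<d} * (spectral_norm A * vec_norm2 v)"
    by (intro mult_left_mono vec_norm2_le_spectral_norm[OF A v] L2_set_nonneg)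
  also have "\<dots> = spectral_norm A * ip d x x"
    by (simp add: L L2_set_def ip_def power2_eq_square sum_nonneg)
  finally show ?thesis .
qed

text \<open>The form is a nonnegatively weighted sum of products of two polynomial values.
  Cauchy-Schwarz over all nodes, each weight split into two square roots, reduces it to the large
  sieve for \<open>y\<close> and for \<open>x\<close>.\<close>

lemma op_le_light:
  assumes q: "0 < q" and D: "16 * d \<le> D" "0 < D"
    and w: "\<And>b r. 0 \<le> w b r" and mass: "\<And>b. b < D \<Longrightarrow> (\<Sum>r<q. w b r) \<le> \<tau>"
  shows "op_le d (\<lambda>i j. \<Sum>b<D. \<Sum>r<q. w b r * cos ((real i - real j) * node D q b r)) (9 * real D * \<tau>)"
  unfolding op_le_def
proof (intro allI)
  fix x y :: "nat \<Rightarrow> real"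
  define S where "S = {..<D} \<times> {..<q}"
  define u where "u z p = (case p of (b, r) \<Rightarrow> sqrt (w b r) * cmod (tpoly d z (node D q b r)))" for z p
  have tau: "0 \<le> \<tau>" using mass[of 0] D w by (meson order_trans sum_nonneg)
  have u: "L2_set (u z) S \<le> sqrt (9 * real D * \<tau>) * L2_set z {..<d}" for z
  proof -
    have "(\<Sum>p\<in>S. (u z p)\<^sup>2) = (\<Sum>b<D. \<Sum>r<q. w b r * (cmod (tpoly d z (node D q b r)))\<^sup>2)"
      unfolding sum.cartesian_product S_def using w
      by (intro sum.cong refl) (auto simp: u_def power_mult_distrib)
    also have "\<dots> \<le> 9 * real D * \<tau> * (\<Sum>j<d. (z j)\<^sup>2)" by (rule large_sieve[OF assms])
    finally have "L2_set (u z) S \<le> sqrt (9 * real D * \<tau> * (\<Sum>j<d. (z j)\<^sup>2))" by (simp add: L2_set_def)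
    then show ?thesis by (simp add: L2_set_def real_sqrt_mult)
  qed
  have "(\<Sum>i<d. \<Sum>j<d. y i * (\<Sum>b<D. \<Sum>r<q. w b r * cos ((real i - real j) * node D q b r)) * x j)
     = (\<Sum>i<d. \<Sum>j<d. \<Sum>p\<in>S. case p of (b, r) \<Rightarrow> w b r * (y i * cos ((real i - real j) * node D q b r) * x j))"
    unfolding sum.cartesian_product S_def sum_distrib_left sum_distrib_right
    by (intro sum.cong refl) auto
  also have "\<dots> = (\<Sum>p\<in>S. \<Sum>i<d. \<Sum>j<d. case p of (b, r) \<Rightarrow> w b r * (y i * cos ((real i - real j) * node D q b r) * x j))"
    by (simp only: sum.swap[of _ S])
  also have "\<dots> = (\<Sum>p\<in>S. case p of (b, r) \<Rightarrow> w b r * Re (cnj (tpoly d y (node D q b r)) * tpoly d x (node D q b r)))"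
    unfolding tpoly_inner by (intro sum.cong refl) (auto simp: sum_distrib_left)
  finally have "\<bar>\<Sum>i<d. \<Sum>j<d. y i * (\<Sum>b<D. \<Sum>r<q. w b r * cos ((real i - real j) * node D q b r)) * x j\<bar>
     \<le> (\<Sum>p\<in>S. \<bar>case p of (b, r) \<Rightarrow> w b r * Re (cnj (tpoly d y (node D q b r)) * tpoly d x (node D q b r))\<bar>)"
    by (simp only: sum_abs)
  also have "\<dots> \<le> (\<Sum>p\<in>S. \<bar>u y p\<bar> * \<bar>u x p\<bar>)"
  proof (rule sum_mono, clarify)
    fix b r
    have "\<bar>w b r * Re (cnj (tpoly d y (node D q b r)) * tpoly d x (node D q b r))\<bar>
      \<le> w b r * cmod (cnj (tpoly d y (node D q b r)) * tpoly d x (node D q b r))"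
      using w by (simp only: abs_mult abs_of_nonneg) (intro mult_left_mono abs_Re_le_cmod, simp)
    also have "\<dots> = (sqrt (w b r) * sqrt (w b r)) * (cmod (tpoly d y (node D q b r)) * cmod (tpoly d x (node D q b r)))"
      using w by (simp add: norm_mult)
    also have "\<dots> = \<bar>u y (b, r)\<bar> * \<bar>u x (b, r)\<bar>"
      using w by (simp add: u_def abs_mult)
    finally show "\<bar>w b r * Re (cnj (tpoly d y (node D q b r)) * tpoly d x (node D q b r))\<bar>
      \<le> \<bar>u y (b, r)\<bar> * \<bar>u x (b, r)\<bar>" .
  qed
  also have "\<dots> \<le> L2_set (u y) S * L2_set (u x) S" by (rule L2_set_mult_ineq)
  also have "\<dots> \<le> (sqrt (9 * real D * \<tau>) * L2_set y {..<d}) * (sqrt (9 * real D * \<tau>) * L2_set x {..<d})"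
    using tau by (intro mult_mono u mult_nonneg_nonneg L2_set_nonneg) auto
  also have "\<dots> = 9 * real D * \<tau> * (L2_set y {..<d} * L2_set x {..<d})"
  proof -
    have "sqrt (9 * real D * \<tau>) * sqrt (9 * real D * \<tau>) = 9 * real D * \<tau>" using tau by simp
    then show ?thesis by (metis mult.assoc mult.left_commute)
  qed
  finally show "\<bar>\<Sum>i<d. \<Sum>j<d. y i * (\<Sum>b<D. \<Sum>r<q. w b r * cos ((real i - real j) * node D q b r)) * x j\<bar>
     \<le> 9 * real D * \<tau> * (L2_set y {..<d} * L2_set x {..<d})" .
qed

section \<open>Taylor truncation of a bucket\<close>

text \<open>From order \<open>n\<close> on, the factorials are dropped and the tail is dominated by
  a geometric series of ratio 1/2.\<close>

lemma exp_taylor_half: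
  fixes z :: complex
  assumes "cmod z \<le> 1 / 2"
  shows "cmod (exp z - (\<Sum>p<n. z ^ p / fact p)) \<le> 2 * (1 / 2) ^ n"
proof -
  have "(\<lambda>p. z ^ p / fact p) sums exp z"
    using exp_converges[of z] by (simp add: scaleR_conv_of_real field_simps)
  then have 1: "(\<lambda>p. z ^ (p + n) / fact (p + n)) sums (exp z - (\<Sum>p<n. z ^ p / fact p))"
    by (rule sums_split_initial_segment)
  have "(\<lambda>p. (1 / 2 :: real) ^ n * (1 / 2) ^ p) sums ((1 / 2) ^ n * (1 / (1 - 1 / 2)))"
    by (intro sums_mult geometric_sums) simp
  then have 2: "(\<lambda>p. (1 / 2 :: real) ^ (p + n)) sums (2 * (1 / 2) ^ n)"
    by (simp add: power_add mult.commute)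
  have "cmod (z ^ (p + n) / fact (p + n)) \<le> (1 / 2) ^ (p + n)" for p
  proof -
    have "cmod (z ^ (p + n) / fact (p + n)) = cmod z ^ (p + n) / fact (p + n)"
      by (simp add: norm_divide norm_power)
    also have "\<dots> \<le> cmod z ^ (p + n) / 1" by (intro divide_left_mono) (auto simp: fact_ge_1)
    also have "\<dots> \<le> (1 / 2) ^ (p + n)" using power_mono[OF assms, of "p + n"] by simp
    finally show ?thesis .
  qed
  then show ?thesis by (intro norm_sums_le[OF 1 2])
qed

definition taylor_coeff :: "nat \<Rightarrow> nat \<Rightarrow> (nat \<Rightarrow> nat \<Rightarrow> real) \<Rightarrow> nat \<Rightarrow> nat \<Rightarrow> real" where
  "taylor_coeff D q w b p = (\<Sum>r<q. w b r * (2 * pi * real r / (real q * real D)) ^ p / fact p)"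

text \<open>The contribution of the buckets in \<open>H\<close> with the exponential of the
  in-bucket offset truncated to \<open>n\<close> terms: a sum of modulated polynomials in
  \<open>u\<close>, which stands for \<open>i - j\<close>.\<close>

definition taylor_diag :: "nat \<Rightarrow> nat \<Rightarrow> (nat \<Rightarrow> nat \<Rightarrow> real) \<Rightarrow> nat \<Rightarrow> nat set \<Rightarrow> real \<Rightarrow> real" where
  "taylor_diag D q w n H u =
    Re (\<Sum>b\<in>H. cis (u * (2 * pi * real b / real D)) *
      (\<Sum>p<n. (\<i> * of_real u) ^ p * of_real (taylor_coeff D q w b p)))"

text \<open>The coefficients are real, so negating \<open>u\<close> conjugates the sum. This makes
  the approximant symmetric.\<close>

lemma taylor_diag_minus: "taylor_diag D q w n H (- u) = taylor_diag D q w n H u"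
proof -
  have "(\<Sum>b\<in>H. cis (- u * (2 * pi * real b / real D)) *
      (\<Sum>p<n. (\<i> * of_real (- u)) ^ p * of_real (taylor_coeff D q w b p)))
    = cnj (\<Sum>b\<in>H. cis (u * (2 * pi * real b / real D)) *
      (\<Sum>p<n. (\<i> * of_real u) ^ p * of_real (taylor_coeff D q w b p)))"
    by (simp add: cis_cnj)
  then show ?thesis by (simp only: taylor_diag_def cnj.sel)
qed

text \<open>With \<open>16 * d\<close> buckets the phase inside a bucket is at most
  \<open>d * g r\<close>, which is below \<open>pi / 8\<close> and hence below 1/2, so the Taylor
  remainder bound applies at every node.\<close>

lemma taylor_diag_error:
  assumes q: "0 < q" and d: "0 < d" and w: "\<And>b r. 0 \<le> w b r" and u: "\<bar>u\<bar> \<le> real d"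
  shows "\<bar>(\<Sum>b\<in>H. \<Sum>r<q. w b r * cos (u * node (16 * d) q b r)) - taylor_diag (16 * d) q w n H u\<bar>
    \<le> 2 * (1 / 2) ^ n * (\<Sum>b\<in>H. \<Sum>r<q. w b r)"
proof -
  define D where "D = 16 * d"
  define g where "g r = 2 * pi * real r / (real q * real D)" for r
  have tc: "taylor_coeff D q w b p = (\<Sum>r<q. w b r * g r ^ p / fact p)" for b p
    by (simp only: taylor_coeff_def g_def)
  define E where "E r = exp (\<i> * of_real (u * g r)) - (\<Sum>p<n. (\<i> * of_real (u * g r)) ^ p / fact p)" for r
  have E: "cmod (E r) \<le> 2 * (1 / 2) ^ n" if r: "r < q" for r
    unfolding E_def
  proof (rule exp_taylor_half)
    have g0: "0 \<le> g r" by (simp add: g_def)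
    have "\<bar>u\<bar> * g r \<le> real d * g r" using u g0 by (intro mult_right_mono)
    also have "\<dots> = pi / 8 * (real r / real q)" using d by (simp add: g_def D_def)
    also have "\<dots> \<le> pi / 8 * 1" using r by (intro mult_left_mono) auto
    also have "\<dots> \<le> 1 / 2" using pi_less_4 by simp
    finally show "cmod (\<i> * of_real (u * g r)) \<le> 1 / 2"
      using g0 by (simp add: norm_mult abs_mult)
  qed
  have "(\<Sum>b\<in>H. \<Sum>r<q. w b r * cos (u * node D q b r)) - taylor_diag D q w n H u
     = Re (\<Sum>b\<in>H. \<Sum>r<q. of_real (w b r) * cis (u * (2 * pi * real b / real D)) * E r)"
  proof -
    have "w b r * cos (u * node D q b r)
      = Re (of_real (w b r) * cis (u * (2 * pi * real b / real D)) * exp (\<i> * of_real (u * g r)))" for b r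
    proof -
      have "cis (u * (2 * pi * real b / real D)) * exp (\<i> * of_real (u * g r)) = cis (u * node D q b r)"
        unfolding cis_conv_exp[symmetric] cis_mult by (simp only: node_def g_def distrib_left)
      then show ?thesis by (simp add: mult.assoc)
    qed
    moreover have "(\<Sum>p<n. (\<i> * of_real u) ^ p * of_real (taylor_coeff D q w b p))
      = (\<Sum>r<q. of_real (w b r) * (\<Sum>p<n. (\<i> * of_real (u * g r)) ^ p / fact p))" for b
      unfolding tc sum_distrib_left of_real_sum
      by (subst sum.swap) (simp add: power_mult_distrib mult_ac)
    then have "taylor_diag D q w n H u = Re (\<Sum>b\<in>H. \<Sum>r<q. of_real (w b r) *
        cis (u * (2 * pi * real b / real D)) * (\<Sum>p<n. (\<i> * of_real (u * g r)) ^ p / fact p))"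
      unfolding taylor_diag_def by (simp only: sum_distrib_left[of "cis _"] mult.left_commute mult.assoc)
    ultimately show ?thesis
      by (simp only: E_def right_diff_distrib sum_subtractf minus_complex.sel Re_sum)
  qed
  also have "\<bar>\<dots>\<bar> \<le> (\<Sum>b\<in>H. \<Sum>r<q. w b r * (2 * (1 / 2) ^ n))"
  proof (rule order_trans[OF abs_Re_le_cmod], intro sum_norm_le)
    fix b r assume "r \<in> {..<q}"
    then show "cmod (of_real (w b r) * cis (u * (2 * pi * real b / real D)) * E r) \<le> w b r * (2 * (1 / 2) ^ n)"
      using E[of r] w[of b r] by (simp add: norm_mult mult_left_mono)
  qed
  also have "\<dots> = 2 * (1 / 2) ^ n * (\<Sum>b\<in>H. \<Sum>r<q. w b r)"
    by (simp only: sum_distrib_right[symmetric] mult.commute)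
  finally show ?thesis by (simp only: D_def)
qed

text \<open>The binomial theorem separates the powers of \<open>i - j\<close>. In bucket
  \<open>b\<close> the dependence on \<open>i\<close> is spanned by the functions
  \<open>cis (i * \<theta> b) * i ^ s\<close> with \<open>s < n\<close>, so each bucket costs
  \<open>n\<close> products, doubled by the real part.\<close>

lemma taylor_diag_rank:
  assumes "finite H"
  shows "vec_space.rank d (mat d d (\<lambda>(i, j). taylor_diag D q w n H (real i - real j))) \<le> 2 * (card H * n)"
proof -
  define \<theta> where "\<theta> b = 2 * pi * real b / real D" for b :: nat
  define \<kappa> where "\<kappa> b p = \<i> ^ p * complex_of_real (taylor_coeff D q w b p)" for b p
  define f where "f = (\<lambda>(b, s) i. cis (real i * \<theta> b) * of_nat i ^ s)"
  define g where "g = (\<lambda>(b, s) j. cis (- (real j * \<theta> b)) *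
    (\<Sum>p<n. \<kappa> b p * of_nat (p choose s) * (- of_nat j) ^ (p - s)))"
  have "taylor_diag D q w n H (real i - real j) = Re (\<Sum>l\<in>H \<times> {..<n}. f l i * g l j)" for i j
  proof -
    have pow: "(\<i> * of_real (real i - real j)) ^ p * of_real (taylor_coeff D q w b p)
      = (\<Sum>s<n. \<kappa> b p * of_nat (p choose s) * (of_nat i ^ s * (- of_nat j) ^ (p - s)))" if p: "p < n" for b p
    proof -
      have "(of_nat i + - of_nat j :: complex) ^ p = (\<Sum>s\<le>p. of_nat (p choose s) * of_nat i ^ s * (- of_nat j) ^ (p - s))"
        by (rule binomial_ring)
      \<comment> \<open>The binomial coefficient vanishes for \<open>s > p\<close>, so the range can
        be made independent of \<open>p\<close>.\<close>
      also have "\<dots> = (\<Sum>s<n. of_nat (p choose s) * of_nat i ^ s * (- of_nat j) ^ (p - s))"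
        using p by (intro sum.mono_neutral_left) auto
      finally have "(\<i> * of_real (real i - real j)) ^ p * of_real (taylor_coeff D q w b p)
        = \<kappa> b p * (\<Sum>s<n. of_nat (p choose s) * of_nat i ^ s * (- of_nat j) ^ (p - s))"
        by (simp add: \<kappa>_def power_mult_distrib mult_ac)
      then show ?thesis by (simp add: sum_distrib_left mult.assoc)
    qed
    have "cis ((real i - real j) * \<theta> b) * (\<Sum>p<n. (\<i> * of_real (real i - real j)) ^ p * of_real (taylor_coeff D q w b p))
       = (\<Sum>s<n. f (b, s) i * g (b, s) j)" for b
    proof -
      have c: "cis ((real i - real j) * \<theta> b) = cis (real i * \<theta> b) * cis (- (real j * \<theta> b))"
        by (simp add: cis_mult left_diff_distrib)
      have "(\<Sum>p<n. (\<i> * of_real (real i - real j)) ^ p * of_real (taylor_coeff D q w b p))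
        = (\<Sum>s<n. of_nat i ^ s * (\<Sum>p<n. \<kappa> b p * of_nat (p choose s) * (- of_nat j) ^ (p - s)))"
      proof -
        have "(\<Sum>p<n. (\<i> * of_real (real i - real j)) ^ p * of_real (taylor_coeff D q w b p))
          = (\<Sum>p<n. \<Sum>s<n. \<kappa> b p * of_nat (p choose s) * (of_nat i ^ s * (- of_nat j) ^ (p - s)))"
          by (intro sum.cong refl pow) simp
        also have "\<dots> = (\<Sum>s<n. of_nat i ^ s * (\<Sum>p<n. \<kappa> b p * of_nat (p choose s) * (- of_nat j) ^ (p - s)))"
          by (subst sum.swap) (simp add: sum_distrib_left mult_ac)
        finally show ?thesis .
      qed
      then show ?thesis unfolding c f_def g_def by (simp add: sum_distrib_left mult_ac)
    qed
    then show ?thesis by (simp add: taylor_diag_def \<theta>_def[symmetric] sum.cartesian_product)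
  qed
  then have "mat d d (\<lambda>(i, j). taylor_diag D q w n H (real i - real j))
    = mat d d (\<lambda>(i, j). Re (\<Sum>l\<in>H \<times> {..<n}. f l i * g l j))" by simp
  moreover have "vec_space.rank d \<dots> \<le> 2 * card (H \<times> {..<n})"
    by (rule rank_sum_Re_products) (use assms in simp)
  ultimately show ?thesis by (simp add: card_cartesian_product)
qed

text \<open>The order is the rounded-up binary logarithm of \<open>8 * d / \<delta>\<close>. As
  \<open>ln 2 \<ge> 1 / 2\<close>, it is at most \<open>5 + 2 * u + 2 * M\<close>, where
  \<open>u\<close> and \<open>M\<close> are the two factors of the claimed bound; both are at least
  1, so \<open>9 * u * M\<close> absorbs the sum.\<close>

lemma exists_taylor_order:
  assumes d: "0 < d" and \<delta>: "0 < \<delta>" "\<delta> < 1"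
  shows "\<exists>n. 8 * real d / \<delta> \<le> 2 ^ n \<and> real n \<le> 9 * (1 + ln (1 + real d)) * max 1 (ln (1 / \<delta>))"
proof -
  define X where "X = 8 * real d / \<delta>"
  define n where "n = nat \<lceil>ln X / ln 2\<rceil>"
  have X: "1 \<le> X" using d \<delta> by (simp add: X_def field_simps)
  \<comment> \<open>Both bounds come from \<open>ln x \<le> x - 1\<close>, at 1/2 and at 2.\<close>
  have ln2: "1 / 2 \<le> ln (2 :: real)" "ln (2 :: real) \<le> 1"
    using ln_le_minus_one[of "1 / 2 :: real"] ln_le_minus_one[of "2 :: real"] by (simp_all add: ln_div)
  have "ln X / ln 2 \<le> real n" unfolding n_def by linarith
  then have "ln X \<le> real n * ln 2" using ln2 by (simp add: field_simps)
  then have "ln X \<le> ln (2 ^ n)" by (simp add: ln_realpow)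
  then have "X \<le> 2 ^ n" using X by simp
  moreover have "real n \<le> 9 * (1 + ln (1 + real d)) * max 1 (ln (1 / \<delta>))"
  proof -
    define u where "u = 1 + ln (1 + real d)"
    define M where "M = max 1 (ln (1 / \<delta>))"
    have uM: "1 \<le> u" "1 \<le> M" by (simp_all add: u_def M_def)
    have "0 \<le> ln X / ln 2" using X ln2 by simp
    then have "real n \<le> ln X / ln 2 + 1" unfolding n_def by linarith
    also have "ln X / ln 2 \<le> ln X / (1 / 2)" using X ln2 by (intro divide_left_mono) auto
    also have "ln X = 3 * ln 2 + ln (real d) + ln (1 / \<delta>)"
    proof -
      have "ln X = ln (2 ^ 3 * real d * (1 / \<delta>))" by (simp add: X_def)
      also have "\<dots> = ln (2 ^ 3) + ln (real d) + ln (1 / \<delta>)"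
        using d \<delta> by (subst ln_mult_pos, simp, simp, subst ln_mult_pos) auto
      also have "ln ((2 :: real) ^ 3) = 3 * ln 2" by (subst ln_realpow) simp_all
      finally show ?thesis .
    qed
    also have "(3 * ln 2 + ln (real d) + ln (1 / \<delta>)) / (1 / 2) + 1 \<le> 5 + 2 * u + 2 * M"
    proof -
      have "ln (real d) \<le> u - 1" using d by (simp add: u_def)
      moreover have "ln (1 / \<delta>) \<le> M" by (simp add: M_def)
      ultimately show ?thesis using ln2 by simp
    qed
    also have "\<dots> \<le> 9 * u * M"
    proof -
      have "u * 1 \<le> u * M" "1 * M \<le> u * M" using uM by (intro mult_mono; simp)+
      then show ?thesis using uM by linarith
    qed
    finally show ?thesis by (simp add: u_def M_def)
  qed
  ultimately show ?thesis unfolding X_def by blast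
qed

section \<open>Low-rank Toeplitz approximation\<close>

lemma toeplitz_gap:
  assumes T: "T \<in> carrier_mat d d" "toeplitz T" "symmetric_mat T" and ij: "i < d" "j < d"
  shows "T $$ (i, j) = T $$ (gap i j, 0)"
proof -
  have lower: "T $$ (i, j) = T $$ (gap i j, 0)" if "j \<le> i" "i < d" for i j
  proof -
    have "gap i j = i - j" "int i - int j = int (i - j) - int 0"
      using that by (simp_all add: gap_def)
    moreover have "i < dim_row T" "j < dim_col T" "i - j < dim_row T" "0 < dim_col T"
      using T(1) that by auto
    ultimately show ?thesis using T(2) unfolding toeplitz_def by metis
  qed
  show ?thesis
  proof (cases "j \<le> i")
    case False
    have "T $$ (i, j) = transpose_mat T $$ (j, i)" using T(1) ij by simp
    also have "\<dots> = T $$ (j, i)" using T(3) by (simp add: symmetric_mat_def)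
    finally show ?thesis using lower[of i j] False ij by (simp add: gap_sym)
  qed (use lower ij in blast)
qed

lemma psd_mat_quadratic_form:
  assumes T: "T \<in> carrier_mat d d" "psd_mat T"
  shows "0 \<le> (\<Sum>i<d. \<Sum>j<d. x i * T $$ (i, j) * x j)"
proof -
  have x: "vec d x \<in> carrier_vec d" by simp
  then have "0 \<le> vec d x \<bullet> (T *\<^sub>v vec d x)" using T by (auto simp: psd_mat_def)
  also have "\<dots> = (\<Sum>i<d. x i * (T *\<^sub>v vec d x) $ i)"
    using T(1) by (simp add: scalar_prod_def lessThan_atLeast0)
  also have "\<dots> = (\<Sum>i<d. \<Sum>j<d. x i * T $$ (i, j) * x j)"
    using mult_mat_vec_entry[OF T(1) x] by (simp add: sum_distrib_left mult.assoc)
  finally show ?thesis .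
qed

lemma abs_entry_le_frobenius_norm:
  assumes T: "T \<in> carrier_mat d d" and ij: "i < d" "j < d"
  shows "\<bar>T $$ (i, j)\<bar> \<le> frobenius_norm T"
proof -
  have "(T $$ (i, j))\<^sup>2 \<le> (\<Sum>j<d. (T $$ (i, j))\<^sup>2)"
    using ij by (intro member_le_sum[of j "{..<d}" "\<lambda>j. (T $$ (i, j))\<^sup>2"]) auto
  also have "\<dots> \<le> (\<Sum>i<d. \<Sum>j<d. (T $$ (i, j))\<^sup>2)"
    using ij by (intro member_le_sum[of i "{..<d}" "\<lambda>i. \<Sum>j<d. (T $$ (i, j))\<^sup>2"]) (auto intro: sum_nonneg)
  finally have "sqrt ((T $$ (i, j))\<^sup>2) \<le> sqrt (\<Sum>i<d. \<Sum>j<d. (T $$ (i, j))\<^sup>2)"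
    by (rule real_sqrt_le_mono)
  then show ?thesis using T by (simp add: frobenius_norm_def)
qed

lemma frobenius_norm_nonneg: "0 \<le> frobenius_norm T"
  by (simp add: frobenius_norm_def sum_nonneg)

text \<open>\<open>T - T'\<close> is a sum of three errors: quadrature, light buckets, and Taylor
  truncation of the heavy buckets. The rank is at most twice the number of heavy buckets times
  \<open>n\<close>.\<close>

lemma psd_toeplitz_low_rank:
  fixes T B :: "real mat"
  assumes d: "0 < d" and T: "T \<in> carrier_mat d d" "toeplitz T" "psd_mat T"
    and \<delta>: "0 < \<delta>" "8 * real d / \<delta> \<le> 2 ^ n" "\<delta> < 1"
    and B: "B \<in> carrier_mat d d" "vec_space.rank d B \<le> k"
    and F: "0 < frobenius_norm T"
  shows "\<exists>T'. T' \<in> carrier_mat d d \<and> symmetric_mat T' \<and> toeplitz T' \<and>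
    vec_space.rank d T' \<le> 147456 * (k * n) \<and>
    spectral_norm (T - T') \<le> 4608 * spectral_norm (T - B) + \<delta> * frobenius_norm T"
proof -
  define t where "t n = T $$ (n, 0)" for n
  define D where "D = 16 * d"
  \<comment> \<open>9218 is 2 * 4609: the quadrature error \<open>d * \<eta>\<close> enters once
    directly and 4608 times through \<open>\<sigma>\<close>, together half of the allowed
    \<open>\<delta> * frobenius_norm T\<close>.\<close>
  define \<eta> where "\<eta> = \<delta> * frobenius_norm T / (9218 * real d)"
  \<comment> \<open>This bounds the form of the quadrature matrix on the annihilator of
    \<open>Q\<close>, where \<open>B\<close> vanishes. The added term keeps \<open>\<sigma>\<close>
    positive even if \<open>T = B\<close>.\<close>
  define \<sigma> where "\<sigma> = spectral_norm (T - B) + real d * \<eta>"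
  have sym: "symmetric_mat T" using T(3) by (simp add: psd_mat_def)
  have Tt: "T $$ (i, j) = t (gap i j)" if "i < d" "j < d" for i j
    using toeplitz_gap[OF T(1,2) sym that] by (simp add: t_def)
  have \<eta>: "0 < \<eta>" using d \<delta> F by (simp add: \<eta>_def)
  have D: "0 < D" "16 * d \<le> D" using d by (simp_all add: D_def)
  have TB: "T - B \<in> carrier_mat d d" using T(1) B(1) by auto
  have \<sigma>: "0 < \<sigma>" unfolding \<sigma>_def
    using spectral_norm_nonneg[OF TB] d \<eta> by (intro add_nonneg_pos) auto
  have "0 \<le> (\<Sum>i<d. \<Sum>j<d. x i * t (gap i j) * x j)" for x
    using psd_mat_quadratic_form[OF T(1,3), of x] by (simp add: Tt)
  from psd_toeplitz_approx_moments[OF this d \<eta> D(1)] obtain q w where q: "0 < q"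
    and w: "\<And>b r. 0 \<le> w b r"
    and mom: "\<And>n. n < d \<Longrightarrow> \<bar>(\<Sum>b<D. \<Sum>r<q. w b r * cos (real n * node D q b r)) - t n\<bar> \<le> \<eta>"
    by blast
  define L where "L i j = (\<Sum>b<D. \<Sum>r<q. w b r * cos ((real i - real j) * node D q b r))" for i j
  have LT: "\<bar>L i j - T $$ (i, j)\<bar> \<le> \<eta>" if "i < d" "j < d" for i j
    using mom[OF gap_less[OF that]] by (simp add: L_def cos_gap Tt that)
  obtain Q m where m: "m \<le> k" and Q: "orthonormal d m Q"
    and ann: "\<And>x i. \<forall>l<m. ip d (Q l) x = 0 \<Longrightarrow> i < d \<Longrightarrow> (\<Sum>j<d. B $$ (i, j) * x j) = 0"
  proof -
    obtain W where "\<forall>x. (\<forall>i<k. ip d (W i) x = 0) \<longrightarrow> (\<forall>i<d. (\<Sum>j<d. B $$ (i, j) * x j) = 0)"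
      using rank_annihilator[OF B] by blast
    moreover obtain Q m where "m \<le> k" "orthonormal d m Q"
      "\<forall>x. (\<forall>i<m. ip d (Q i) x = 0) \<longrightarrow> (\<forall>i<k. ip d (W i) x = 0)"
      using gram_schmidt_annihilator[of k d W] by blast
    ultimately show ?thesis using that[of m Q] by meson
  qed
  have small: "(\<Sum>b<D. \<Sum>r<q. w b r * (cmod (tpoly d x (node D q b r)))\<^sup>2) \<le> \<sigma> * ip d x x"
    if x: "\<forall>i<m. ip d (Q i) x = 0" for x
  proof -
    have "(\<Sum>b<D. \<Sum>r<q. w b r * (cmod (tpoly d x (node D q b r)))\<^sup>2)
      = (\<Sum>b<D. \<Sum>r<q. \<Sum>i<d. \<Sum>j<d. x i * (w b r * cos ((real i - real j) * node D q b r)) * x j)"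
      by (simp add: tpoly_norm_sq sum_distrib_left mult_ac)
    also have "\<dots> = (\<Sum>i<d. \<Sum>j<d. \<Sum>b<D. \<Sum>r<q. x i * (w b r * cos ((real i - real j) * node D q b r)) * x j)"
      by (simp only: sum.swap[of _ "{..<d}" "{..<q}"] sum.swap[of _ "{..<d}" "{..<D}"])
    also have "\<dots> = (\<Sum>i<d. \<Sum>j<d. x i * L i j * x j)"
      by (simp add: L_def sum_distrib_left sum_distrib_right)
    also have "\<dots> = (\<Sum>i<d. \<Sum>j<d. x i * (L i j - T $$ (i, j)) * x j) + (\<Sum>i<d. x i * (\<Sum>j<d. (T - B) $$ (i, j) * x j))"
    proof -
      \<comment> \<open>On the annihilator of \<open>Q\<close>, \<open>T\<close> may be replaced by
        \<open>T - B\<close>.\<close>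
      have "(\<Sum>j<d. (T - B) $$ (i, j) * x j) = (\<Sum>j<d. T $$ (i, j) * x j)" if i: "i < d" for i
        using ann[OF x i] T(1) B(1) i by (simp add: left_diff_distrib sum_subtractf)
      then show ?thesis
        by (simp add: sum_distrib_left sum.distrib[symmetric] algebra_simps)
    qed
    also have "\<dots> \<le> real d * \<eta> * ip d x x + spectral_norm (T - B) * ip d x x"
    proof (rule add_mono)
      have "op_le d (\<lambda>i j. L i j - T $$ (i, j)) (real d * \<eta>)"
        using LT \<eta> by (intro op_le_entrywise) auto
      from this[unfolded op_le_def, rule_format, of x x]
      have "(\<Sum>i<d. \<Sum>j<d. x i * (L i j - T $$ (i, j)) * x j) \<le> real d * \<eta> * (L2_set x {..<d} * L2_set x {..<d})"
        by linarith
      also have "L2_set x {..<d} * L2_set x {..<d} = ip d x x"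
        by (simp add: L2_set_def ip_def power2_eq_square sum_nonneg)
      finally show "(\<Sum>i<d. \<Sum>j<d. x i * (L i j - T $$ (i, j)) * x j) \<le> real d * \<eta> * ip d x x" .
    qed (rule quadratic_form_le_spectral_norm[OF TB])
    finally show ?thesis by (simp add: \<sigma>_def algebra_simps)
  qed
  define \<tau> where "\<tau> = 32 * \<sigma> / real d"
  define H where "H = {b. b < D \<and> \<tau> < (\<Sum>r<q. w b r)}"
  have H: "H \<subseteq> {..<D}" "finite H" by (auto simp: H_def)
  have "card H \<le> 73728 * m"
    unfolding H_def \<tau>_def D_def
    by (rule heavy_buckets_card[OF d q w \<sigma> Q]) (use small in \<open>simp add: D_def\<close>)
  then have cardH: "card H \<le> 73728 * k" using m by linarith
  define M where "M i j = taylor_diag D q w n H (real i - real j)" for i j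
  define T' where "T' = mat d d (\<lambda>(i, j). M i j)"
  have T': "T' \<in> carrier_mat d d" by (simp add: T'_def)
  have "M i j = M j i" for i j
    using taylor_diag_minus[of D q w n H "real i - real j"] by (simp add: M_def)
  then have "symmetric_mat T'" by (auto simp: symmetric_mat_def T'_def)
  moreover have "toeplitz T'"
    unfolding toeplitz_def
  proof (intro allI impI)
    fix i j i' j'
    assume "i < dim_row T'" "j < dim_col T'" "i' < dim_row T'" "j' < dim_col T'" "int i - int j = int i' - int j'"
    moreover from this(5) have "real i - real j = real i' - real j'" by linarith
    ultimately show "T' $$ (i, j) = T' $$ (i', j')" by (simp add: T'_def M_def)
  qed
  moreover have "vec_space.rank d T' \<le> 147456 * (k * n)"
  proof -
    have "vec_space.rank d T' \<le> 2 * (card H * n)"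
      unfolding T'_def M_def by (rule taylor_diag_rank[OF H(2)])
    also have "\<dots> \<le> 2 * (73728 * k * n)" using cardH by (intro mult_left_mono mult_right_mono) auto
    finally show ?thesis by simp
  qed
  moreover have "spectral_norm (T - T') \<le> 4608 * spectral_norm (T - B) + \<delta> * frobenius_norm T"
  proof -
    \<comment> \<open>The light part keeps all \<open>D\<close> buckets, with the heavy weights set
      to 0, as the large sieve expects.\<close>
    define v where "v b r = (if b \<in> H then 0 else w b r)" for b r
    define A where "A i j = (\<Sum>b<D. \<Sum>r<q. v b r * cos ((real i - real j) * node D q b r))" for i j
    define L\<^sub>H where "L\<^sub>H i j = (\<Sum>b\<in>H. \<Sum>r<q. w b r * cos ((real i - real j) * node D q b r))" for i j
    have split: "L i j = A i j + L\<^sub>H i j" for i j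
    proof -
      have "A i j = (\<Sum>b\<in>{..<D} - H. \<Sum>r<q. w b r * cos ((real i - real j) * node D q b r))"
        unfolding A_def v_def by (rule sum.mono_neutral_cong_right) (use H in auto)
      then show ?thesis
        unfolding L_def L\<^sub>H_def using sum.subset_diff[OF H(1)] by simp
    qed
    have \<tau>: "0 \<le> \<tau>" using \<sigma> by (simp add: \<tau>_def)
    have "op_le d A (9 * real D * \<tau>)"
      unfolding A_def[abs_def]
    proof (rule op_le_light[OF q D(2,1)])
      show "0 \<le> v b r" for b r using w by (simp add: v_def)
      show "(\<Sum>r<q. v b r) \<le> \<tau>" if "b < D" for b
        using \<tau> that by (cases "b \<in> H") (auto simp: v_def H_def not_less)
    qed
    moreover have "9 * real D * \<tau> = 4608 * \<sigma>" using d by (simp add: D_def \<tau>_def)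
    ultimately have light: "op_le d A (4608 * \<sigma>)" by simp
    have mass: "(\<Sum>b\<in>H. \<Sum>r<q. w b r) \<le> 2 * frobenius_norm T"
    proof -
      have "(\<Sum>b\<in>H. \<Sum>r<q. w b r) \<le> (\<Sum>b<D. \<Sum>r<q. w b r)"
        using H w by (intro sum_mono2) (auto intro: sum_nonneg)
      \<comment> \<open>The total mass is the zeroth cosine moment.\<close>
      also have "\<dots> \<le> t 0 + \<eta>" using mom[OF d] by simp
      also have "t 0 \<le> frobenius_norm T"
        using abs_entry_le_frobenius_norm[OF T(1) d d] by (simp add: t_def)
      also have "\<eta> \<le> frobenius_norm T"
      proof -
        have "\<delta> * frobenius_norm T \<le> (9218 * real d) * frobenius_norm T"
          using \<delta> d F by (intro mult_right_mono) auto
        then show ?thesis using d by (simp add: \<eta>_def field_simps)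
      qed
      finally show ?thesis by simp
    qed
    \<comment> \<open>The truncation error is at most \<open>4 * frobenius_norm T / 2 ^ n\<close>
      per entry. Passing to the operator norm costs a factor \<open>d\<close>, which the
      \<open>8 * d\<close> in the choice of \<open>n\<close> pays for; the result is the other half
      of the allowed error.\<close>
    have half: "2 * (1 / 2) ^ n * (2 * frobenius_norm T) \<le> \<delta> * frobenius_norm T / (2 * real d)"
    proof -
      have "8 * real d \<le> 2 ^ n * \<delta>" using \<delta> by (simp add: field_simps)
      then have "8 * real d * frobenius_norm T \<le> 2 ^ n * \<delta> * frobenius_norm T"
        using F by (intro mult_right_mono) auto
      then show ?thesis using d by (simp add: power_one_over field_simps)
    qed
    have "\<bar>L\<^sub>H i j - M i j\<bar> \<le> \<delta> * frobenius_norm T / (2 * real d)" if "i < d" "j < d" for i j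
    proof -
      have "\<bar>L\<^sub>H i j - M i j\<bar> \<le> 2 * (1 / 2) ^ n * (\<Sum>b\<in>H. \<Sum>r<q. w b r)"
        unfolding L\<^sub>H_def M_def D_def by (rule taylor_diag_error[OF q d w]) (use that in simp)
      also have "\<dots> \<le> 2 * (1 / 2) ^ n * (2 * frobenius_norm T)"
        by (intro mult_left_mono mass) simp
      finally show ?thesis using half by linarith
    qed
    then have "op_le d (\<lambda>i j. L\<^sub>H i j - M i j) (real d * (\<delta> * frobenius_norm T / (2 * real d)))"
      using \<delta> F by (intro op_le_entrywise) auto
    then have heavy: "op_le d (\<lambda>i j. L\<^sub>H i j - M i j) (\<delta> * frobenius_norm T / 2)" using d by simp
    have "\<bar>T $$ (i, j) - L i j\<bar> \<le> \<eta>" if "i < d" "j < d" for i j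
      using LT[OF that] by linarith
    then have "op_le d (\<lambda>i j. T $$ (i, j) - L i j) (real d * \<eta>)"
      using \<eta> by (intro op_le_entrywise) auto
    from op_le_add[OF op_le_add[OF this light] heavy]
    have "op_le d (\<lambda>i j. T $$ (i, j) - M i j) (real d * \<eta> + 4608 * \<sigma> + \<delta> * frobenius_norm T / 2)"
      by (simp add: split)
    moreover have "real d * \<eta> + 4608 * \<sigma> + \<delta> * frobenius_norm T / 2
        = 4608 * spectral_norm (T - B) + \<delta> * frobenius_norm T"
      using d by (simp add: \<sigma>_def \<eta>_def field_simps)
    ultimately have op: "op_le d (\<lambda>i j. T $$ (i, j) - M i j) (4608 * spectral_norm (T - B) + \<delta> * frobenius_norm T)"
      by simp
    show ?thesis
    proof (rule spectral_norm_le)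
      show "T - T' \<in> carrier_mat d d" using T(1) T' by auto
      show "op_le d (\<lambda>i j. (T - T') $$ (i, j)) (4608 * spectral_norm (T - B) + \<delta> * frobenius_norm T)"
        using op T(1) by (simp add: op_le_def T'_def)
      show "0 \<le> 4608 * spectral_norm (T - B) + \<delta> * frobenius_norm T"
        using spectral_norm_nonneg[OF TB] \<delta> F by simp
    qed
  qed
  ultimately show ?thesis using T' by blast
qed

(* max 1 (ln (1/\<delta>)): the customary reading of log (1/\<delta>) inside an asymptotic bound.
   Without the cutoff the rank would be forced to 0 as \<delta> tends to 1, which fails
   already for the all-ones matrix with k = 1. *)
theorem theorem5:
  "\<exists>(C :: real) (a :: nat) (C' :: real) (a' :: nat).
     \<forall>(d :: nat) (T :: real mat) (\<delta> :: real) (k :: nat) (T\<^sub>k :: real mat).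
       T \<in> carrier_mat d d \<and> toeplitz T \<and> psd_mat T \<and>
       0 < \<delta> \<and> \<delta> < 1 \<and> k \<le> d \<and> best_rank_approx d k T T\<^sub>k \<longrightarrow>
       (\<exists>T'. T' \<in> carrier_mat d d \<and> symmetric_mat T' \<and> toeplitz T' \<and>
          real (vec_space.rank d T') \<le> soft_O C a d (real k * max 1 (ln (1 / \<delta>))) \<and>
          spectral_norm (T - T')
            \<le> soft_O C' a' d 1 * spectral_norm (T - T\<^sub>k) + \<delta> * frobenius_norm T)"
proof (rule exI[of _ 1327104], rule exI[of _ 1], rule exI[of _ 4608], rule exI[of _ 0], intro allI impI)
  \<comment> \<open>1327104 is 147456 * 9, and the logarithm of exponent 1 comes from the Taylor
    order. The approximation factor is the constant 4608, hence exponent 0 there.\<close>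
  fix d k :: nat and T T\<^sub>k :: "real mat" and \<delta> :: real
  assume "T \<in> carrier_mat d d \<and> toeplitz T \<and> psd_mat T \<and>
    0 < \<delta> \<and> \<delta> < 1 \<and> k \<le> d \<and> best_rank_approx d k T T\<^sub>k"
  then have T: "T \<in> carrier_mat d d" "toeplitz T" "psd_mat T" and \<delta>: "0 < \<delta>" "\<delta> < 1"
    and Tk: "T\<^sub>k \<in> carrier_mat d d" "vec_space.rank d T\<^sub>k \<le> k"
    by (auto simp: best_rank_approx_def is_arg_min_def)
  define m where "m = max 1 (ln (1 / \<delta>))"
  have m: "1 \<le> m" by (simp add: m_def)
  \<comment> \<open>The last factor of \<open>soft_O\<close> is at least 1, so it may be
    inserted.\<close>
  have "real k * (1 + ln (1 + real d)) * m * 1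
      \<le> real k * (1 + ln (1 + real d)) * m * (1 + ln (1 + real k * m))"
    using m by (intro mult_left_mono) auto
  then have "1327104 * (real k * (1 + ln (1 + real d)) * m * 1)
      \<le> 1327104 * (real k * (1 + ln (1 + real d)) * m * (1 + ln (1 + real k * m)))"
    by (rule mult_left_mono) simp
  then have soft: "1327104 * (real k * (1 + ln (1 + real d)) * m) \<le> soft_O 1327104 1 d (real k * m)"
    by (simp only: soft_O_def power_one_right mult_1_right mult_ac)
  have one: "soft_O 4608 0 d 1 = 4608" by (simp add: soft_O_def)
  have nn: "0 \<le> spectral_norm (T - T\<^sub>k)" using T Tk by (intro spectral_norm_nonneg[of _ d]) auto
  show "\<exists>T'. T' \<in> carrier_mat d d \<and> symmetric_mat T' \<and> toeplitz T' \<and>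
      real (vec_space.rank d T') \<le> soft_O 1327104 1 d (real k * max 1 (ln (1 / \<delta>))) \<and>
      spectral_norm (T - T') \<le> soft_O 4608 0 d 1 * spectral_norm (T - T\<^sub>k) + \<delta> * frobenius_norm T"
  proof (cases "0 < frobenius_norm T")
    case True
    then have d: "0 < d" using T(1) by (cases "d = 0") (auto simp: frobenius_norm_def)
    obtain n where n: "8 * real d / \<delta> \<le> 2 ^ n" "real n \<le> 9 * (1 + ln (1 + real d)) * m"
      using exists_taylor_order[OF d \<delta>] unfolding m_def by blast
    obtain T' where T': "T' \<in> carrier_mat d d" "symmetric_mat T'" "toeplitz T'"
      "vec_space.rank d T' \<le> 147456 * (k * n)"
      "spectral_norm (T - T') \<le> 4608 * spectral_norm (T - T\<^sub>k) + \<delta> * frobenius_norm T"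
      using psd_toeplitz_low_rank[OF d T \<delta>(1) n(1) \<delta>(2) Tk True] by blast
    have "real (vec_space.rank d T') \<le> real (147456 * (k * n))" using T'(4) by (simp only: of_nat_le_iff)
    also have "\<dots> = 147456 * (real k * real n)" by simp
    also have "\<dots> \<le> 147456 * (real k * (9 * (1 + ln (1 + real d)) * m))"
      using n(2) by (intro mult_left_mono) auto
    also have "\<dots> = 1327104 * (real k * (1 + ln (1 + real d)) * m)" by simp
    also note soft
    finally show ?thesis using T' unfolding one m_def by blast
  next
    \<comment> \<open>A vanishing Frobenius norm means \<open>T = 0\<close>, which serves as its own
      approximation; this also covers \<open>d = 0\<close>.\<close>
    case False
    then have F: "frobenius_norm T = 0" using frobenius_norm_nonneg[of T] by simp
    have T0: "T = 0\<^sub>m d d"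
      using T(1) abs_entry_le_frobenius_norm[OF T(1)] F by (intro eq_matI) auto
    have "spectral_norm (T - T) \<le> real d * 0"
      using T(1) by (intro spectral_norm_le[of _ d] op_le_entrywise) auto
    then have "spectral_norm (T - T) \<le> soft_O 4608 0 d 1 * spectral_norm (T - T\<^sub>k) + \<delta> * frobenius_norm T"
      using nn by (simp add: one F)
    moreover have "real (vec_space.rank d T) \<le> soft_O 1327104 1 d (real k * max 1 (ln (1 / \<delta>)))"
    proof -
      have "0 \<le> 1327104 * (real k * (1 + ln (1 + real d)) * m)" using m by simp
      also note soft
      finally show ?thesis unfolding T0 vec_space.rank_0I m_def by simp
    qed
    moreover have "symmetric_mat T" using T(3) by (simp add: psd_mat_def)
    ultimately show ?thesis using T by blast
  qed
qed

end
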